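(* Let $X\sim P\in\mathcal{E}(O,\Lambda)$, where $O=(o_1,\ldots,o_p)\in\mathcal{O}^p$ and $\Lambda\in\mathcal{D}_1^p$. Let $f_P(v)=\mathrm{E}(\|X-v\|\,\|X+v\|-\|X\|^2)$ for $v\in\mathbb{R}^p$, and let $\phi_1(S_P)$ be the largest eigenvalue of $S_P=\mathrm{E}(XX'/\|X\|^2)$. (i) If $\phi_1(S_P)>1/2$, then there exists $\psi>0$ such that the minimizers of $f_P$ over $\mathbb{R}^p$ are precisely the vectors $v=\pm\psi o_1$. (ii) If $\phi_1(S_P)\le 1/2$, then $f_P$ is uniquely minimized over $\mathbb{R}^p$ at $v=0$.
   Context: Let $p\ge 2$ be an integer. $\|\cdot\|$ is the Euclidean norm and $'$ denotes transpose. $\mathcal{O}^p$ is the set of $p\times p$ orthogonal matrices; $o_1,\ldots,o_p$ denote the columns of $O$. $\mathcal{D}_1^p=\{\sigma\,\mathrm{diag}(\lambda,1,\ldots,1)\mid \sigma>0,\ \lambda>1\}$ (diagonal $p\times p$ matrices). For fixed $O\in\mathcal{O}^p$ and $\Lambda\in\mathcal{D}_1^p$, a probability distribution $P$ on $\mathbb{R}^p$ belongs to $\mathcal{E}(O,\Lambda)$ if $X\sim P$ admits the representation $X=O\Lambda Z$ for some random $p$-vector $Z$ such that: (1) $Z$ is spherical, i.e. $VZ$ has the same distribution as $Z$ for every $V\in\mathcal{O}^p$; (2) $R:=\|Z\|$ admits a density $f_R:(0,\infty)\to(0,\infty)$ with respect to Lebesgue measure; (3) $r\mapsto f_R(r)/r^{p-1}$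 is strictly decreasing on $(0,\infty)$; (4) $\mathrm{E}(R)<\infty$. The matrix $S_P$ is the spatial sign covariance matrix of $P$. The expectation defining $f_P(v)$ is finite for every $v$. *)

theory Defs
  imports "HOL-Probability.Probability"
begin

text \<open>
  Vectors of dimension \<open>p\<close> are elements of \<^typ>\<open>real ^ 'n\<close>, so that \<open>p\<close> is \<open>CARD('n)\<close>. The finite
  index type carries no order; the parameter \<open>k\<close> below is the index playing the role of the first
  coordinate, so that \<open>o\<^sub>1\<close> is \<open>column k U\<close>.
\<close>

definition diagonal_matrix :: "('n \<Rightarrow> real) \<Rightarrow> real ^ 'n ^ 'n" where
  "diagonal_matrix d = (\<chi> i j. if i = j then d i else 0)"

definition spiked_scatter :: "'n \<Rightarrow> (real ^ 'n ^ 'n) set" where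
  "spiked_scatter k =
     {\<sigma> *\<^sub>R diagonal_matrix (\<lambda>i. if i = k then l else 1) | \<sigma> l. \<sigma> > 0 \<and> l > 1}"

definition spherical :: "(real ^ 'n) measure \<Rightarrow> bool" where
  "spherical Q \<longleftrightarrow> (\<forall>V. orthogonal_matrix V \<longrightarrow> distr Q borel (\<lambda>z. V *v z) = Q)"

text \<open>
  The density of the radius is a function on the positive half-line, here extended by \<open>0\<close> to the
  real line.
\<close>

definition radial_density :: "(real ^ 'n) measure \<Rightarrow> (real \<Rightarrow> real) \<Rightarrow> bool" where
  "radial_density Q f \<longleftrightarrow>
     (\<forall>r>0. f r > 0) \<and>
     distributed Q lborel norm (\<lambda>r. ennreal (f r * indicator {0<..} r))"

text \<open>
  The measure \<open>Q\<close> is the law of the spherical vector \<open>Z\<close>, and \<open>P\<close> is the law of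
  \<open>X = U \<Lambda> Z\<close>.
\<close>

definition elliptical_class ::
  "real ^ 'n ^ 'n \<Rightarrow> real ^ 'n ^ 'n \<Rightarrow> (real ^ 'n) measure set" where
  "elliptical_class U L =
     {distr Q borel (\<lambda>z. (U ** L) *v z) | Q.
        prob_space Q \<and> sets Q = sets borel \<and>
        spherical Q \<and>
        (\<exists>f. radial_density Q f \<and>
             strict_antimono_on {0<..} (\<lambda>r. f r / r ^ (CARD('n) - 1))) \<and>
        integrable Q norm}"

text \<open>
  The integrand is \<open>0\<close> at \<open>x = 0\<close>, which is a null event for every member of
  \<^const>\<open>elliptical_class\<close> with \<open>U\<close> and \<open>L\<close> invertible.
\<close>

definition sign_covariance :: "(real ^ 'n) measure \<Rightarrow> real ^ 'n ^ 'n" where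
  "sign_covariance P =
     (LINT x|P. (1 / (norm x)\<^sup>2) *\<^sub>R ((columnvector x :: real ^ 1 ^ 'n) ** rowvector x))"

definition eigenvalues :: "real ^ 'n ^ 'n \<Rightarrow> real set" where
  "eigenvalues A = {c. \<exists>v. v \<noteq> 0 \<and> A *v v = c *\<^sub>R v}"

text \<open>
  The set of eigenvalues is finite, and it is nonempty if \<open>A\<close> is symmetric.
\<close>

definition largest_eigenvalue :: "real ^ 'n ^ 'n \<Rightarrow> real" where
  "largest_eigenvalue A = Max (eigenvalues A)"

definition pair_objective :: "(real ^ 'n) measure \<Rightarrow> real ^ 'n \<Rightarrow> real" where
  "pair_objective P v = (LINT x|P. norm (x - v) * norm (x + v) - (norm x)\<^sup>2)"

definition minimizers :: "('a \<Rightarrow> real) \<Rightarrow> 'a set" where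
  "minimizers f = {v. is_arg_min f (\<lambda>_. True) v}"

end

theory Submission
  imports Defs
begin

text \<open>
  A spherical law is determined by the law of its radius, so \<open>Q\<close>, and hence \<open>P\<close>, has a Lebesgue
  density; writing \<open>u\<close> for the first column of \<open>U\<close>, the density of \<open>P\<close> on each sphere is a strictly
  increasing function of \<open>(u \<bullet> x)\<^sup>2\<close>. For fixed \<open>x\<close> and \<open>\<parallel>v\<parallel>\<close>, the integrand
  \<open>\<parallel>x - v\<parallel> \<parallel>x + v\<parallel> = sqrt ((\<parallel>x\<parallel>\<^sup>2 + \<parallel>v\<parallel>\<^sup>2)\<^sup>2 - 4 (v \<bullet> x)\<^sup>2)\<close> decreases with \<open>(v \<bullet> x)\<^sup>2\<close>. Averaging over the
  reflection that exchanges \<open>v\<close> and \<open>\<parallel>v\<parallel> u\<close> therefore shows that the objective is smaller at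
  \<open>\<parallel>v\<parallel> u\<close> than at \<open>v\<close>, strictly unless \<open>v\<close> lies on the line of \<open>u\<close>; the same reflection identifies
  the largest eigenvalue as \<open>m = E ((u \<bullet> X)\<^sup>2 / \<parallel>X\<parallel>\<^sup>2)\<close>. On that line, as a function of \<open>s = \<parallel>v\<parallel>\<^sup>2\<close>, the
  integrand is the norm of a point moving along a line in the plane that misses the origin. So the
  objective is strictly convex in \<open>s \<ge> 0\<close>, with right derivative \<open>1 - 2 m\<close> at \<open>0\<close> and slope tending
  to \<open>1\<close> at infinity.
\<close>

section \<open>Lebesgue measure under linear maps\<close>

lemma linear_borel_measurable:
  fixes f :: "'a::euclidean_space \<Rightarrow> 'b::euclidean_space"
  assumes "linear f"
  shows "f \<in> borel_measurable borel"
  using assms by (intro borel_measurable_continuous_onI linear_continuous_on linear_linear[THEN iffD2])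

lemma orthogonal_transformation_borel_measurable:
  fixes f :: "'a::euclidean_space \<Rightarrow> 'a"
  assumes "orthogonal_transformation f"
  shows "f \<in> borel_measurable borel"
  by (rule linear_borel_measurable[OF orthogonal_transformation_linear[OF assms]])

text \<open>The ball indicator as a function of centre and point together: one measurability rule
  then covers both arguments wherever Fubini is applied.\<close>

definition ball_kernel :: "real \<Rightarrow> 'a::metric_space \<Rightarrow> 'a \<Rightarrow> ennreal" where
  "ball_kernel e y x = (if dist y x < e then 1 else 0)"

lemma borel_measurable_ball_kernel [measurable]:
  fixes g h :: "'b \<Rightarrow> 'a::{metric_space, second_countable_topology}"
  assumes [measurable]: "g \<in> borel_measurable N" "h \<in> borel_measurable N"
  shows "(\<lambda>p. ball_kernel e (g p) (h p)) \<in> borel_measurable N"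
  unfolding ball_kernel_def by measurable

lemma emeasure_ball_eq_ball_kernel:
  fixes N :: "'a::{metric_space, second_countable_topology} measure"
  assumes "sets N = sets borel"
  shows "emeasure N (ball y e) = (\<integral>\<^sup>+x. ball_kernel e y x \<partial>N)"
  using assms by (subst nn_integral_indicator[symmetric])
    (auto simp: ball_kernel_def indicator_def intro!: nn_integral_cong simp del: nn_integral_indicator)

lemma emeasure_lborel_open_pos:
  fixes S :: "'a::euclidean_space set"
  assumes "open S" "S \<noteq> {}"
  shows "0 < emeasure lborel S"
proof -
  obtain x e where "e > 0" "ball x e \<subseteq> S"
    using assms by (meson ex_in_conv openE)
  then have "0 < emeasure lborel (ball x e)" "emeasure lborel (ball x e) \<le> emeasure lborel S"
    using \<open>open S\<close> by (simp add: emeasure_ball, intro emeasure_mono) auto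
  then show ?thesis by order
qed

text \<open>The image measure is translation invariant, and the usual argument for the uniqueness of Haar
  measure applies: integrate \<open>1\<^sub>A(T z) 1\<^sub>B(y - T z)\<close> over \<open>(y, z)\<close> in both orders.\<close>

lemma linear_distr_lborel:
  fixes T :: "'a::euclidean_space \<Rightarrow> 'a"
  assumes "linear T" "bij T"
  shows "\<exists>c>0. distr lborel borel T = density lborel (\<lambda>_. ennreal c)"
proof -
  have [measurable]: "T \<in> borel_measurable borel"
    using \<open>linear T\<close> by (rule linear_borel_measurable)
  obtain S where S: "linear S" "\<And>x. S (T x) = x" "\<And>x. T (S x) = x"
    using assms inj_linear_imp_inv_linear[of T] by (metis bij_is_inj bij_is_surj inv_f_f surj_f_inv_f)
  have [measurable]: "S \<in> borel_measurable borel"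
    using \<open>linear S\<close> by (rule linear_borel_measurable)
  let ?B = "ball (0::'a) 1"
  let ?b = "emeasure lborel ?B" and ?d = "emeasure lborel (T -` ?B)"
  have shift: "(\<integral>\<^sup>+x. f (x + a) \<partial>lborel) = (\<integral>\<^sup>+x. f x \<partial>lborel)"
    if [measurable]: "f \<in> borel_measurable borel" for f :: "'a \<Rightarrow> ennreal" and a
    by (subst (2) lborel_distr_plus[of a, symmetric]) (simp add: nn_integral_distr add.commute)
  have main: "emeasure lborel (T -` A) * ?b = emeasure lborel A * ?d"
    if [measurable]: "A \<in> sets borel" for A
  proof -
    have [measurable]: "T -` A \<in> sets borel"
      using measurable_sets[of T borel borel A] by simp
    have [measurable]: "T -` ?B \<in> sets borel"
      using measurable_sets[of T borel borel ?B] by simp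
    have "emeasure lborel (T -` A) * ?b = (\<integral>\<^sup>+z. indicator A (T z) \<partial>lborel) * ?b"
      by (subst nn_integral_indicator[symmetric]) (auto intro!: arg_cong2[where f="(*)"] nn_integral_cong simp: indicator_def simp del: nn_integral_indicator)
    also have "\<dots> = (\<integral>\<^sup>+z. \<integral>\<^sup>+y. indicator A (T z) * ball_kernel 1 (T z) y \<partial>lborel \<partial>lborel)"
    proof (subst nn_integral_multc[symmetric], simp, rule nn_integral_cong)
      fix z
      have "(\<integral>\<^sup>+y. ball_kernel 1 (T z) y \<partial>lborel) = ?b"
        by (simp add: emeasure_ball flip: emeasure_ball_eq_ball_kernel)
      then show "indicator A (T z) * ?b = (\<integral>\<^sup>+y. indicator A (T z) * ball_kernel 1 (T z) y \<partial>lborel)"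
        by (subst nn_integral_cmult) auto
    qed
    also have "\<dots> = (\<integral>\<^sup>+y. \<integral>\<^sup>+z. indicator A (T z) * ball_kernel 1 (T z) y \<partial>lborel \<partial>lborel)"
      by (rule lborel_pair.Fubini') measurable
    also have "\<dots> = (\<integral>\<^sup>+y. \<integral>\<^sup>+z. indicator A (T z + y) * indicator (T -` ?B) z \<partial>lborel \<partial>lborel)"
    proof (rule nn_integral_cong)
      \<comment> \<open>Translating \<open>z\<close> by \<open>S y\<close> replaces
        \<open>T z\<close> by \<open>T z + y\<close>, so the ball condition becomes
        \<open>norm (T z) < 1\<close> and no longer involves \<open>y\<close>.\<close>
      fix y
      have "(\<integral>\<^sup>+z. indicator A (T z) * ball_kernel 1 (T z) y \<partial>lborel)
          = (\<integral>\<^sup>+z. indicator A (T (z + S y)) * ball_kernel 1 (T (z + S y)) y \<partial>lborel)"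
        by (rule shift[symmetric]) measurable
      also have "\<dots> = (\<integral>\<^sup>+z. indicator A (T z + y) * indicator (T -` ?B) z \<partial>lborel)"
        using \<open>linear T\<close> S by (intro nn_integral_cong) (auto simp: linear_add indicator_def ball_kernel_def dist_norm)
      finally show "(\<integral>\<^sup>+z. indicator A (T z) * ball_kernel 1 (T z) y \<partial>lborel)
          = (\<integral>\<^sup>+z. indicator A (T z + y) * indicator (T -` ?B) z \<partial>lborel)" .
    qed
    also have "\<dots> = (\<integral>\<^sup>+z. \<integral>\<^sup>+y. indicator A (T z + y) * indicator (T -` ?B) z \<partial>lborel \<partial>lborel)"
      by (rule lborel_pair.Fubini') measurable
    also have "\<dots> = (\<integral>\<^sup>+z. emeasure lborel A * indicator (T -` ?B) z \<partial>lborel)"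
    proof (rule nn_integral_cong)
      fix z
      have "(\<integral>\<^sup>+y. indicator A (T z + y) \<partial>lborel) = emeasure lborel A"
        using shift[of "indicator A" "T z", OF borel_measurable_indicator] by (simp add: add.commute)
      then show "(\<integral>\<^sup>+y. indicator A (T z + y) * indicator (T -` ?B) z \<partial>lborel) = emeasure lborel A * indicator (T -` ?B) z"
        by (subst nn_integral_multc) auto
    qed
    also have "\<dots> = emeasure lborel A * (\<integral>\<^sup>+z. indicator (T -` ?B) z \<partial>lborel)"
      by (subst nn_integral_cmult[symmetric]) (auto intro!: nn_integral_cong simp: indicator_def measurable_sets_borel)
    also have "(\<integral>\<^sup>+z. indicator (T -` ?B) z \<partial>lborel) = ?d"
      by (simp add: measurable_sets_borel)
    finally show ?thesis .
  qed
  \<comment> \<open>Both volumes must be positive and finite for their ratio to be the scaling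
    factor; the preimage of the ball is open, nonempty and bounded.\<close>
  have b: "0 < ?b" "?b < \<infinity>"
    using emeasure_lborel_ball_finite[of "0::'a" 1] by (simp_all add: emeasure_lborel_open_pos)
  have "open (T -` ?B)"
    using \<open>linear T\<close> by (intro open_vimage linear_continuous_on linear_linear[THEN iffD2]) auto
  moreover have "T -` ?B \<noteq> {}"
  proof -
    have "0 \<in> T -` ?B" using \<open>linear T\<close> by (simp add: linear_0)
    then show ?thesis by blast
  qed
  moreover have "bounded (T -` ?B)"
  proof -
    have "T -` ?B \<subseteq> S ` ?B"
      using S by (metis image_eqI subsetI vimageE)
    moreover have "bounded (S ` ?B)"
      using S(1) by (intro bounded_linear_image) (auto simp: linear_linear)
    ultimately show ?thesis by (rule bounded_subset[rotated])
  qed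
  ultimately have d: "0 < ?d" "?d < \<infinity>"
    using emeasure_bounded_finite[of "T -` ?B"] emeasure_lborel_open_pos[of "T -` ?B"] by auto
  obtain b' d' where b': "?b = ennreal b'" "b' > 0" and d': "?d = ennreal d'" "d' > 0"
    using b d by (cases ?b; cases ?d) auto
  have "distr lborel borel T = density lborel (\<lambda>_. ennreal (d' / b'))"
  proof (rule measure_eqI)
    fix A assume "A \<in> sets (distr lborel borel T)"
    then have [measurable]: "A \<in> sets borel" by simp
    have "emeasure (distr lborel borel T) A * ?b = emeasure lborel A * ?d"
      using main[of A] by (simp add: emeasure_distr)
    then have "emeasure (distr lborel borel T) A = emeasure lborel A * ?d / ?b"
      using b by (metis ennreal_mult_divide_eq infinity_ennreal_def less_irrefl)
    also have "\<dots> = emeasure lborel A * ennreal (d' / b')"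
      using b' d' by (simp add: ennreal_times_divide[symmetric] divide_ennreal)
    finally show "emeasure (distr lborel borel T) A = emeasure (density lborel (\<lambda>_. ennreal (d' / b'))) A"
      by (simp add: emeasure_density_const mult.commute)
  qed simp
  then show ?thesis
    using b' d' by (intro exI[of _ "d' / b'"]) auto
qed
text \<open>The unit ball is its own preimage and has positive finite volume, which forces the
  scaling factor to be 1.\<close>

lemma orthogonal_distr_lborel:
  fixes f :: "'a::euclidean_space \<Rightarrow> 'a"
  assumes f: "orthogonal_transformation f"
  shows "distr lborel borel f = lborel"
proof -
  have lin: "linear f" using f by (rule orthogonal_transformation_linear)
  obtain c where c: "c > 0" "distr lborel borel f = density lborel (\<lambda>_. ennreal c)"
    using linear_distr_lborel[OF lin orthogonal_transformation_bij[OF f]] by blast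
  have [measurable]: "f \<in> borel_measurable borel"
    using lin by (rule linear_borel_measurable)
  let ?B = "ball (0::'a) 1"
  have "f -` ?B = ?B"
    using f by (auto simp: orthogonal_transformation_norm)
  then have "emeasure lborel ?B = ennreal c * emeasure lborel ?B"
    using arg_cong[OF c(2), of "\<lambda>M. emeasure M ?B"] by (simp add: emeasure_distr emeasure_density_const)
  moreover have "unit_ball_vol (real DIM('a)) \<noteq> 0"
    by (metis less_irrefl of_nat_0_le_iff unit_ball_vol_pos)
  ultimately have "c = 1"
    using c(1) by (auto simp: emeasure_ball simp flip: ennreal_mult ennreal_1)
  then show ?thesis
    using c(2) by (simp add: density_1)
qed

section \<open>Spherical measures with equal radial laws\<close>

text \<open>The complement is a union of open balls centred outside \<open>A\<close>. This makes the
  inner parallel sets of \<open>A\<close> measurable.\<close>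

lemma closed_ball_subset:
  fixes A :: "'a::metric_space set"
  shows "closed {x. ball x e \<subseteq> A}"
proof -
  have "- {x. ball x e \<subseteq> A} = (\<Union>z\<in>-A. ball z e)"
    by (auto simp: dist_commute)
  then show ?thesis
    by (metis closed_def open_UN open_ball)
qed

text \<open>Orthogonal maps act transitively on spheres, so \<open>w\<close> is a function of the
  norm and its integral sees only the radial law.\<close>

lemma radial_nn_integral_eq:
  fixes Q M :: "(real ^ 'n) measure"
  assumes [measurable_cong]: "sets Q = sets borel" "sets M = sets borel"
    and norm: "distr Q borel norm = distr M borel norm"
    and [measurable]: "w \<in> borel_measurable borel"
    and w: "\<And>f x. orthogonal_transformation f \<Longrightarrow> w (f x) = w x"
  shows "(\<integral>\<^sup>+x. w x \<partial>Q) = (\<integral>\<^sup>+x. w x \<partial>M)"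
proof -
  \<comment> \<open>Any coordinate axis serves as the reference direction.\<close>
  let ?u = "\<lambda>r. w (r *\<^sub>R axis undefined 1)"
  have eq: "w x = ?u (norm x)" for x
  proof -
    have "norm x = norm (norm x *\<^sub>R (axis undefined 1 :: real ^ 'n))"
      by (simp add: norm_axis_1)
    then show ?thesis
    proof (rule orthogonal_transformation_exists)
      fix f :: "real ^ 'n \<Rightarrow> real ^ 'n" assume f: "orthogonal_transformation f" "f x = norm x *\<^sub>R axis undefined 1"
      show ?thesis using w[OF f(1), of x] unfolding f(2) by (rule sym)
    qed
  qed
  have "(\<integral>\<^sup>+x. w x \<partial>N) = (\<integral>\<^sup>+r. ?u r \<partial>distr N borel norm)"
    if [measurable_cong]: "sets N = sets borel" for N
    by (subst nn_integral_distr) (measurable, rule nn_integral_cong, rule eq)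
  then show ?thesis by (simp add: norm assms(1,2))
qed

text \<open>The sets \<open>ball y e\<close> have rotation invariant measures as functions of \<open>y\<close>, so the set \<open>S\<close> of
  exceptional \<open>y\<close> is rotation invariant. By Fubini, the integral of the measures over \<open>S\<close> is the
  integral of a function of the norm, and does not distinguish \<open>Q\<close> from \<open>M\<close>.\<close>

lemma radial_ball_le:
  fixes Q M :: "(real ^ 'n) measure"
  assumes fin: "finite_measure Q" "finite_measure M"
    and [measurable_cong]: "sets Q = sets borel" "sets M = sets borel"
    and rot: "\<And>f. orthogonal_transformation f \<Longrightarrow> distr Q borel f = Q"
      "\<And>f. orthogonal_transformation f \<Longrightarrow> distr M borel f = M"
    and norm: "distr Q borel norm = distr M borel norm"
    and "e > 0"
  shows "AE y in lborel. emeasure Q (ball y e) \<le> emeasure M (ball y e)"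
proof -
  interpret Q: finite_measure Q by fact
  interpret M: finite_measure M by fact
  interpret QL: pair_sigma_finite Q lborel ..
  interpret MM: pair_sigma_finite M lborel ..
  let ?k = "ball_kernel e"
  have kf: "?k (f y) (f x) = ?k y x" if "orthogonal_transformation f" for f :: "real ^ 'n \<Rightarrow> real ^ 'n" and x y
    using that unfolding ball_kernel_def dist_norm
    by (simp add: orthogonal_transformation_linear linear_diff[symmetric] orthogonal_transformation_norm)
  define UQ where "UQ y = (\<integral>\<^sup>+x. ?k y x \<partial>Q)" for y
  define UM where "UM y = (\<integral>\<^sup>+x. ?k y x \<partial>M)" for y
  have [measurable]: "UQ \<in> borel_measurable borel" "UM \<in> borel_measurable borel"
    unfolding UQ_def UM_def by measurable
  have UQf: "UQ (f y) = UQ y" if f: "orthogonal_transformation f" for f y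
  proof -
    note [measurable] = orthogonal_transformation_borel_measurable[OF f]
    have "UQ (f y) = (\<integral>\<^sup>+x. ?k (f y) x \<partial>distr Q borel f)"
      using rot(1)[OF f] by (simp add: UQ_def)
    then show ?thesis by (simp add: nn_integral_distr kf f UQ_def)
  qed
  have UMf: "UM (f y) = UM y" if f: "orthogonal_transformation f" for f y
  proof -
    note [measurable] = orthogonal_transformation_borel_measurable[OF f]
    have "UM (f y) = (\<integral>\<^sup>+x. ?k (f y) x \<partial>distr M borel f)"
      using rot(2)[OF f] by (simp add: UM_def)
    then show ?thesis by (simp add: nn_integral_distr kf f UM_def)
  qed
  define S where "S = {y. UM y < UQ y}"
  have [measurable]: "S \<in> sets borel" unfolding S_def by measurable
  have Sf: "f y \<in> S \<longleftrightarrow> y \<in> S" if "orthogonal_transformation f" for f y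
    using that by (simp add: S_def UQf UMf)
  define w where "w x = (\<integral>\<^sup>+y. indicator S y * ?k y x \<partial>lborel)" for x
  have [measurable]: "w \<in> borel_measurable borel" unfolding w_def by measurable
  have wf: "w (f x) = w x" if f: "orthogonal_transformation f" for f x
  proof -
    note [measurable] = orthogonal_transformation_borel_measurable[OF f]
    have "w (f x) = (\<integral>\<^sup>+y. indicator S y * ?k y (f x) \<partial>distr lborel borel f)"
      by (simp add: orthogonal_distr_lborel f w_def)
    also have "\<dots> = w x"
      by (simp add: nn_integral_distr kf f w_def Sf indicator_def)
    finally show ?thesis .
  qed
  have wle: "w x \<le> emeasure lborel (ball x e)" for x
  proof -
    have "w x \<le> (\<integral>\<^sup>+y. indicator (ball x e) y \<partial>lborel)"
      unfolding w_def by (intro nn_integral_mono) (auto simp: ball_kernel_def indicator_def dist_commute)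
    then show ?thesis by simp
  qed
  have "(\<integral>\<^sup>+y. indicator S y * UQ y \<partial>lborel) = (\<integral>\<^sup>+y. \<integral>\<^sup>+x. indicator S y * ?k y x \<partial>Q \<partial>lborel)"
    unfolding UQ_def by (intro nn_integral_cong nn_integral_cmult[symmetric]) measurable
  also have "\<dots> = (\<integral>\<^sup>+x. w x \<partial>Q)"
    unfolding w_def by (rule QL.Fubini') measurable
  finally have IQ: "(\<integral>\<^sup>+y. indicator S y * UQ y \<partial>lborel) = (\<integral>\<^sup>+x. w x \<partial>Q)" .
  have "(\<integral>\<^sup>+y. indicator S y * UM y \<partial>lborel) = (\<integral>\<^sup>+y. \<integral>\<^sup>+x. indicator S y * ?k y x \<partial>M \<partial>lborel)"
    unfolding UM_def by (intro nn_integral_cong nn_integral_cmult[symmetric]) measurable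
  also have "\<dots> = (\<integral>\<^sup>+x. w x \<partial>M)"
    unfolding w_def by (rule MM.Fubini') measurable
  finally have IM: "(\<integral>\<^sup>+y. indicator S y * UM y \<partial>lborel) = (\<integral>\<^sup>+x. w x \<partial>M)" .
  have QM: "(\<integral>\<^sup>+x. w x \<partial>Q) = (\<integral>\<^sup>+x. w x \<partial>M)"
    by (rule radial_nn_integral_eq[OF assms(3,4,7)]) (simp_all add: wf)
  \<comment> \<open>\<open>w\<close> is at most the volume of a ball of radius \<open>e\<close> and
    \<open>M\<close> is finite, so the common integral is finite and can be subtracted in
    \<open>ennreal\<close>.\<close>
  have fin: "(\<integral>\<^sup>+x. w x \<partial>M) < \<infinity>"
  proof -
    have "(\<integral>\<^sup>+x. w x \<partial>M) \<le> (\<integral>\<^sup>+x. emeasure lborel (ball (0::real ^ 'n) e) \<partial>M)"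
      using wle \<open>e > 0\<close> by (intro nn_integral_mono) (simp add: emeasure_ball)
    also have "\<dots> < \<infinity>"
      using emeasure_lborel_ball_finite[of "0::real ^ 'n" e] M.emeasure_finite[of "space M"]
      by (simp add: less_top[symmetric] ennreal_mult_eq_top_iff)
    finally show ?thesis .
  qed
  \<comment> \<open>The integrand is positive exactly on \<open>S\<close>; a vanishing integral
    makes \<open>S\<close> a null set.\<close>
  have "(\<integral>\<^sup>+y. indicator S y * UQ y - indicator S y * UM y \<partial>lborel) = 0"
  proof (subst nn_integral_diff)
    show "(\<integral>\<^sup>+y. indicator S y * UM y \<partial>lborel) \<noteq> \<infinity>"
      using fin IM by simp
    show "AE y in lborel. indicator S y * UM y \<le> indicator S y * UQ y"
      by (rule AE_I2) (auto simp: S_def indicator_def)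
    show "(\<integral>\<^sup>+y. indicator S y * UQ y \<partial>lborel) - (\<integral>\<^sup>+y. indicator S y * UM y \<partial>lborel) = 0"
      unfolding IQ IM QM using fin by (simp add: diff_eq_0_iff_ennreal)
  qed measurable
  then have "AE y in lborel. indicator S y * UQ y - indicator S y * UM y = 0"
    by (subst (asm) nn_integral_0_iff_AE) measurable
  then have "AE y in lborel. UQ y \<le> UM y"
  proof eventually_elim
    case (elim y)
    show ?case
    proof (rule ccontr)
      assume "\<not> UQ y \<le> UM y"
      then have "y \<in> S" by (simp add: S_def)
      with elim have "UQ y - UM y = 0" by (simp only: indicator_simps mult_1)
      with \<open>\<not> UQ y \<le> UM y\<close> show False
        by (simp only: diff_eq_0_iff_ennreal simp_thms)
    qed
  qed
  then show ?thesis by (simp add: emeasure_ball_eq_ball_kernel UQ_def UM_def assms(3,4))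
qed

text \<open>The comparison of balls, known for almost every centre, is averaged over centres by
  Fubini. This gives the inequality with \<open>A\<close> shrunk by \<open>2 * e\<close> on the
  left, and then \<open>e\<close> tends to 0.\<close>

lemma radial_open_le:
  fixes Q M :: "(real ^ 'n) measure"
  assumes fin: "finite_measure Q" "finite_measure M"
    and [measurable_cong]: "sets Q = sets borel" "sets M = sets borel"
    and rot: "\<And>f. orthogonal_transformation f \<Longrightarrow> distr Q borel f = Q"
      "\<And>f. orthogonal_transformation f \<Longrightarrow> distr M borel f = M"
    and norm: "distr Q borel norm = distr M borel norm"
    and "open A"
  shows "emeasure Q A \<le> emeasure M A"
proof -
  interpret Q: finite_measure Q by fact
  interpret M: finite_measure M by fact
  interpret QL: pair_sigma_finite Q lborel ..
  interpret MM: pair_sigma_finite M lborel ..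
  have [measurable]: "A \<in> sets borel" using \<open>open A\<close> by auto
  have le: "emeasure Q {x. ball x (2 * e) \<subseteq> A} \<le> emeasure M A" if "e > 0" for e
  proof -
    let ?k = "ball_kernel e"
    define b where "b = emeasure lborel (ball (0 :: real ^ 'n) e)"
    have b: "0 < b" "b < \<infinity>"
      unfolding b_def using \<open>e > 0\<close>
      by (simp_all only: emeasure_lborel_ball_finite emeasure_lborel_open_pos open_ball ball_eq_empty not_le simp_thms)
    have kb: "(\<integral>\<^sup>+y. ?k y x \<partial>lborel) = b" for x :: "real ^ 'n"
      using emeasure_ball_eq_ball_kernel[of lborel x e] \<open>e > 0\<close>
      by (simp add: ball_kernel_def dist_commute b_def emeasure_ball)
    \<comment> \<open>Centres within \<open>e\<close> of a point of \<open>C\<close> lie in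
      \<open>B\<close>, and balls of radius \<open>e\<close> centred in \<open>B\<close> stay inside
      \<open>A\<close>; hence the two depths \<open>e\<close> and \<open>2 * e\<close>.\<close>
    define B where "B = {x. ball x e \<subseteq> A}"
    define C where "C = {x. ball x (2 * e) \<subseteq> A}"
    have [measurable]: "B \<in> sets borel" "C \<in> sets borel"
      by (simp_all add: B_def C_def closed_ball_subset borel_closed)
    have "emeasure Q C * b = (\<integral>\<^sup>+x. indicator C x * b \<partial>Q)"
      by (subst nn_integral_multc) auto
    also have "\<dots> \<le> (\<integral>\<^sup>+x. \<integral>\<^sup>+y. indicator B y * ?k y x \<partial>lborel \<partial>Q)"
    proof (rule nn_integral_mono)
      fix x
      have "y \<in> B" if "x \<in> C" "dist y x < e" for y
      proof -
        have "ball y e \<subseteq> ball x (2 * e)"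
          using that(2) by (intro subsetI) (simp, metric)
        then show ?thesis using that(1) by (auto simp: B_def C_def)
      qed
      then have "indicator C x * ?k y x \<le> indicator B y * ?k y x" for y
        by (auto simp: ball_kernel_def indicator_def)
      then have "(\<integral>\<^sup>+y. indicator C x * ?k y x \<partial>lborel) \<le> (\<integral>\<^sup>+y. indicator B y * ?k y x \<partial>lborel)"
        by (intro nn_integral_mono)
      then show "indicator C x * b \<le> (\<integral>\<^sup>+y. indicator B y * ?k y x \<partial>lborel)"
        by (subst (asm) nn_integral_cmult) (auto simp: kb)
    qed
    also have "\<dots> = (\<integral>\<^sup>+y. \<integral>\<^sup>+x. indicator B y * ?k y x \<partial>Q \<partial>lborel)"
      by (rule QL.Fubini'[symmetric]) measurable
    also have "\<dots> = (\<integral>\<^sup>+y. indicator B y * emeasure Q (ball y e) \<partial>lborel)"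
      by (intro nn_integral_cong, subst nn_integral_cmult) (auto simp: emeasure_ball_eq_ball_kernel assms(3,4))
    also have "\<dots> \<le> (\<integral>\<^sup>+y. indicator B y * emeasure M (ball y e) \<partial>lborel)"
      using radial_ball_le[OF assms(1-7) \<open>e > 0\<close>]
      by (intro nn_integral_mono_AE) (auto simp: indicator_def)
    also have "\<dots> = (\<integral>\<^sup>+y. \<integral>\<^sup>+x. indicator B y * ?k y x \<partial>M \<partial>lborel)"
      by (intro nn_integral_cong, subst nn_integral_cmult) (auto simp: emeasure_ball_eq_ball_kernel assms(3,4))
    also have "\<dots> = (\<integral>\<^sup>+x. \<integral>\<^sup>+y. indicator B y * ?k y x \<partial>lborel \<partial>M)"
      by (rule MM.Fubini') measurable
    also have "\<dots> \<le> (\<integral>\<^sup>+x. indicator A x * b \<partial>M)"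
    proof (rule nn_integral_mono)
      fix x
      have "indicator B y * ?k y x \<le> indicator A x * ?k y x" for y
        by (auto simp: ball_kernel_def indicator_def B_def)
      then have "(\<integral>\<^sup>+y. indicator B y * ?k y x \<partial>lborel) \<le> (\<integral>\<^sup>+y. indicator A x * ?k y x \<partial>lborel)"
        by (intro nn_integral_mono)
      then show "(\<integral>\<^sup>+y. indicator B y * ?k y x \<partial>lborel) \<le> indicator A x * b"
        by (simp add: nn_integral_cmult kb)
    qed
    also have "\<dots> = emeasure M A * b"
      by (subst nn_integral_multc) auto
    finally have "emeasure Q C * b \<le> emeasure M A * b" .
    then show ?thesis
      using b ennreal_mult_le_mult_iff[of b "emeasure Q C" "emeasure M A"]
      by (simp add: C_def mult.commute)
  qed
  \<comment> \<open>As the depth decreases to 0 the shrunken sets increase to the open set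
    \<open>A\<close>, so continuity from below applies.\<close>
  define C where "C n = {x. ball x (2 * inverse (real (Suc n))) \<subseteq> A}" for n
  have "incseq C"
    unfolding C_def incseq_def
  proof (intro allI impI subsetI CollectI, clarify)
    fix m n x z assume "m \<le> n" "ball x (2 * inverse (real (Suc m))) \<subseteq> A" "z \<in> ball x (2 * inverse (real (Suc n)))"
    moreover have "ball x (2 * inverse (real (Suc n))) \<subseteq> ball x (2 * inverse (real (Suc m)))"
      using \<open>m \<le> n\<close> by (intro subset_ball) (auto simp: field_simps)
    ultimately show "z \<in> A" by blast
  qed
  moreover have "range C \<subseteq> sets Q"
    by (auto simp: C_def closed_ball_subset borel_closed assms(3))
  ultimately have SUP: "(SUP n. emeasure Q (C n)) = emeasure Q (\<Union>n. C n)"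
    by (intro SUP_emeasure_incseq)
  have UN: "(\<Union>n. C n) = A"
  proof (intro equalityI subsetI)
    fix x assume "x \<in> A"
    then obtain d where "d > 0" "ball x d \<subseteq> A" using \<open>open A\<close> openE by blast
    moreover obtain n where "inverse (real (Suc n)) < d / 2"
      using reals_Archimedean[of "d / 2"] \<open>d > 0\<close> by auto
    then have "ball x (2 * inverse (real (Suc n))) \<subseteq> ball x d"
      by (intro subset_ball) auto
    ultimately show "x \<in> (\<Union>n. C n)" by (auto simp: C_def)
  qed (auto simp: C_def)
  have "emeasure Q (C n) \<le> emeasure M A" for n
    unfolding C_def by (rule le) simp
  then have "(SUP n. emeasure Q (C n)) \<le> emeasure M A"
    by (rule SUP_least)
  then show ?thesis
    unfolding SUP UN .
qed

text \<open>The hypotheses are symmetric in \<open>Q\<close> and \<open>M\<close>, so open sets have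
  equal measure, and they form an intersection-stable generator.\<close>

lemma radial_measure_eqI:
  fixes Q M :: "(real ^ 'n) measure"
  assumes fin: "finite_measure Q" "finite_measure M"
    and sets: "sets Q = sets borel" "sets M = sets borel"
    and rot: "\<And>f. orthogonal_transformation f \<Longrightarrow> distr Q borel f = Q"
      "\<And>f. orthogonal_transformation f \<Longrightarrow> distr M borel f = M"
    and norm: "distr Q borel norm = distr M borel norm"
  shows "Q = M"
proof -
  have eq: "emeasure Q X = emeasure M X" if "open X" for X
  proof (rule antisym)
    show "emeasure Q X \<le> emeasure M X"
      by (rule radial_open_le[OF assms that])
    show "emeasure M X \<le> emeasure Q X"
      by (rule radial_open_le[OF fin(2,1) sets(2,1) rot(2,1) norm[symmetric] that])
  qed
  have borel: "sets (borel :: (real ^ 'n) measure) = sigma_sets UNIV {S. open S}"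
    unfolding borel_def by (rule sets_measure_of) simp
  have "emeasure Q UNIV \<noteq> \<infinity>"
    using finite_measure.emeasure_finite[OF fin(1), of UNIV] by simp
  then show ?thesis
  proof (intro measure_eqI_generator_eq[where E="{S. open S}" and \<Omega>=UNIV and A="\<lambda>_. UNIV"])
    show "sets Q = sigma_sets UNIV {S. open S}" "sets M = sigma_sets UNIV {S. open S}"
      unfolding sets borel by (rule refl)+
    show "Int_stable {S :: (real ^ 'n) set. open S}"
      by (simp add: Int_stable_def open_Int)
  qed (auto simp: eq)
qed

text \<open>Polar coordinates for the radius: the density is the derivative of the volume of a ball
  with respect to its radius.\<close>

lemma distr_norm_lborel:
  "distr (lborel :: 'a::euclidean_space measure) borel norm =
     density lborel (\<lambda>r. ennreal (real DIM('a) * unit_ball_vol (real DIM('a)) * r ^ (DIM('a) - 1)) * indicator {0<..} r)"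
    (is "?N = ?D")
proof (rule measure_eqI_generator_eq[where E="range (\<lambda>a::real. {..a})" and \<Omega>=UNIV and A="\<lambda>n. {..real n}"])
  let ?n = "DIM('a)" and ?u = "unit_ball_vol (real DIM('a))"
  have u: "?u \<ge> 0" by (metis less_imp_le of_nat_0_le_iff unit_ball_vol_pos)
  have val: "emeasure ?N {..a} = (if a < 0 then 0 else ennreal (?u * a ^ ?n))" for a
  proof -
    have "norm -` {..a} = cball (0::'a) a" by (auto simp: dist_norm)
    then show ?thesis
      by (auto simp: emeasure_distr emeasure_cball)
  qed
  have "emeasure ?D {..a} = (if a < 0 then 0 else ennreal (?u * a ^ ?n))" for a
  proof (cases "a < 0")
    case True
    then show ?thesis
      by (subst emeasure_density) (auto intro!: nn_integral_zero' simp: indicator_def)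
  next
    case False
    have "emeasure ?D {..a} = (\<integral>\<^sup>+r. ennreal (real ?n * ?u * r ^ (?n - 1)) * indicator {0..a} r \<partial>lborel)"
    proof (subst emeasure_density)
      \<comment> \<open>The point 0, excluded by \<open>{0<..}\<close>, is null, so the fundamental
        theorem can be applied on the closed interval.\<close>
      have "AE r in lborel. r \<noteq> (0::real)" by (rule AE_lborel_singleton)
      then show "(\<integral>\<^sup>+ x. ennreal (real ?n * ?u * x ^ (?n - 1)) * indicator {0<..} x * indicator {..a} x \<partial>lborel)
          = (\<integral>\<^sup>+r. ennreal (real ?n * ?u * r ^ (?n - 1)) * indicator {0..a} r \<partial>lborel)"
        by (intro nn_integral_cong_AE) (auto elim!: eventually_mono simp: indicator_def)
    qed auto
    also have "\<dots> = ?u * a ^ ?n - ?u * 0 ^ ?n"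
    proof (rule nn_integral_FTC_Icc)
      show "((\<lambda>r. ?u * r ^ ?n) has_real_derivative real ?n * ?u * r ^ (?n - 1)) (at r)" for r
        by (auto intro!: derivative_eq_intros)
    qed (use False u in auto)
    finally show ?thesis using False by simp
  qed
  then show "emeasure ?N X = emeasure ?D X" if "X \<in> range (\<lambda>a. {..a})" for X
    using that val by auto
  show "emeasure ?N {..real n} \<noteq> \<infinity>" for n
    by (simp add: val)
  show "Int_stable (range (\<lambda>a::real. {..a}))"
    by (auto simp: Int_stable_def)
  show "sets ?N = sigma_sets UNIV (range (\<lambda>a. {..a}))" "sets ?D = sigma_sets UNIV (range (\<lambda>a. {..a}))"
    by (simp_all add: borel_eq_atMost)
  show "(\<Union>n. {..real n}) = UNIV"
    using real_arch_simple by auto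
qed auto

section \<open>Reflections and the distributions of the spiked model\<close>

text \<open>The normal \<open>a\<close> is not normalised, hence the division by
  \<open>a \<bullet> a\<close>; for \<open>a = 0\<close> the map is the identity.\<close>

definition reflection :: "'a::real_inner \<Rightarrow> 'a \<Rightarrow> 'a" where
  "reflection a x = x - (2 * (a \<bullet> x) / (a \<bullet> a)) *\<^sub>R a"

lemma orthogonal_transformation_reflection: "orthogonal_transformation (reflection a)"
proof -
  have "linear (reflection a)"
    unfolding reflection_def
    by (intro linearI) (simp_all add: algebra_simps inner_add_right add_divide_distrib)
  moreover have "reflection a v \<bullet> reflection a w = v \<bullet> w" for v w
    by (cases "a = 0") (simp_all add: reflection_def inner_diff_left inner_diff_right inner_commute field_simps)
  ultimately show ?thesis
    by (simp add: orthogonal_transformation_def)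
qed

lemma inner_reflection: "x \<bullet> reflection a y = reflection a x \<bullet> y"
  by (simp add: reflection_def inner_diff_left inner_diff_right inner_commute)

lemma norm_reflection [simp]: "norm (reflection a x) = norm x"
  by (rule orthogonal_transformation_norm[OF orthogonal_transformation_reflection])

lemma reflection_minus: "reflection (- a) = reflection a"
  by (simp add: reflection_def fun_eq_iff)

text \<open>For equal norms, \<open>(u - v) \<bullet> (u - v)\<close> is twice
  \<open>(u - v) \<bullet> u\<close>, so exactly one copy of \<open>u - v\<close> is subtracted from
  \<open>u\<close>.\<close>

lemma reflection_swap:
  assumes "norm u = norm v"
  shows "reflection (u - v) u = v"
proof (cases "u = v")
  case False
  have "u \<bullet> u = v \<bullet> v"
    using assms by (simp add: dot_square_norm)
  then have "(u - v) \<bullet> (u - v) = 2 * ((u - v) \<bullet> u)"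
    by (simp add: inner_diff_left inner_diff_right inner_commute)
  moreover have "(u - v) \<bullet> (u - v) \<noteq> 0"
    using False by simp
  ultimately have "2 * ((u - v) \<bullet> u) / ((u - v) \<bullet> (u - v)) = 1"
    by simp
  then show ?thesis by (simp only: reflection_def scaleR_one) simp
qed (simp add: reflection_def)

lemma AE_lborel_inner_neq_0:
  fixes a :: "'a::euclidean_space"
  assumes "a \<noteq> 0"
  shows "AE x in lborel. a \<bullet> x \<noteq> 0"
proof -
  have "{x. a \<bullet> x = 0} \<in> null_sets lebesgue"
    using negligible_hyperplane[of a 0] assms by (simp add: negligible_iff_null_sets)
  moreover have "{x. a \<bullet> x = 0} \<in> sets borel" by measurable
  ultimately have "{x. a \<bullet> x = 0} \<in> null_sets lborel"
    by (simp add: null_sets_def)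
  then show ?thesis by (rule AE_I') auto
qed

section \<open>The integrand of the objective\<close>

definition pair_kernel :: "'a::real_normed_vector \<Rightarrow> 'a \<Rightarrow> real" where
  "pair_kernel v x = norm (x - v) * norm (x + v) - (norm x)\<^sup>2"

lemma pair_kernel_eq:
  fixes x v :: "'a::real_inner"
  shows "pair_kernel v x = sqrt (((norm x)\<^sup>2 + (norm v)\<^sup>2)\<^sup>2 - 4 * (v \<bullet> x)\<^sup>2) - (norm x)\<^sup>2"
proof -
  have "(norm (x - v) * norm (x + v))\<^sup>2 = ((norm x)\<^sup>2 + (norm v)\<^sup>2)\<^sup>2 - 4 * (v \<bullet> x)\<^sup>2"
    by (simp add: power_mult_distrib power2_norm_eq_inner inner_add_left inner_add_right
        inner_diff_left inner_diff_right inner_commute) (simp add: power2_eq_square algebra_simps)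
  then show ?thesis
    unfolding pair_kernel_def by (metis abs_of_nonneg mult_nonneg_nonneg norm_ge_zero real_sqrt_abs)
qed

text \<open>By Cauchy-Schwarz the root lies within \<open>(norm v)\<^sup>2\<close> of
  \<open>(norm x)\<^sup>2\<close>. The bound is free of \<open>x\<close>, which gives
  integrability.\<close>

lemma abs_pair_kernel_le:
  fixes x v :: "'a::real_inner"
  shows "\<bar>pair_kernel v x\<bar> \<le> (norm v)\<^sup>2"
proof -
  have "sqrt (((norm x)\<^sup>2 + (norm v)\<^sup>2)\<^sup>2 - 4 * (v \<bullet> x)\<^sup>2) \<le> (norm x)\<^sup>2 + (norm v)\<^sup>2"
    by (rule real_le_lsqrt) auto
  moreover have "(v \<bullet> x)\<^sup>2 \<le> (norm v)\<^sup>2 * (norm x)\<^sup>2"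
    using Cauchy_Schwarz_ineq[of v x] by (simp add: power2_norm_eq_inner)
  then have "((norm x)\<^sup>2 - (norm v)\<^sup>2)\<^sup>2 \<le> ((norm x)\<^sup>2 + (norm v)\<^sup>2)\<^sup>2 - 4 * (v \<bullet> x)\<^sup>2"
    by (simp add: power2_sum power2_diff)
  then have "(norm x)\<^sup>2 - (norm v)\<^sup>2 \<le> sqrt (((norm x)\<^sup>2 + (norm v)\<^sup>2)\<^sup>2 - 4 * (v \<bullet> x)\<^sup>2)"
    by (rule real_le_rsqrt)
  ultimately show ?thesis
    by (simp add: pair_kernel_eq)
qed

lemma pair_kernel_0 [simp]: "pair_kernel 0 x = 0"
  by (simp add: pair_kernel_def power2_eq_square)

lemma pair_kernel_minus: "pair_kernel (- v) x = pair_kernel v x"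
  by (simp add: pair_kernel_def)

lemma pair_kernel_less_iff:
  fixes v w x :: "'a::real_inner"
  assumes "norm v = norm w"
  shows "pair_kernel v x < pair_kernel w x \<longleftrightarrow> (w \<bullet> x)\<^sup>2 < (v \<bullet> x)\<^sup>2"
  by (simp add: pair_kernel_eq assms)

lemma borel_measurable_pair_kernel [measurable]:
  "pair_kernel v \<in> borel_measurable (borel :: 'a::euclidean_space measure)"
  unfolding pair_kernel_def[abs_def] by measurable

text \<open>What the optimisation uses of the elliptical model. The density \<open>p\<close> is
  fixed as a function, so that its comparisons hold at every point and can be applied to reflected
  points.\<close>

locale spiked_distribution = prob_space P for P :: "'a::euclidean_space measure" +
  fixes u :: 'a and p :: "'a \<Rightarrow> real"
  assumes norm_u: "norm u = 1"
    and p_measurable [measurable]: "p \<in> borel_measurable borel"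
    and p_nonneg: "0 \<le> p x"
    and P_eq: "P = density lborel (\<lambda>x. ennreal (p x))"
    and p_eq: "norm x = norm y \<Longrightarrow> (u \<bullet> x)\<^sup>2 = (u \<bullet> y)\<^sup>2 \<Longrightarrow> p x = p y"
    and p_less: "norm x = norm y \<Longrightarrow> (u \<bullet> x)\<^sup>2 < (u \<bullet> y)\<^sup>2 \<Longrightarrow> p x < p y"
begin

lemma sets_P [measurable_cong]: "sets P = sets borel"
  by (simp add: P_eq)

lemma AE_P:
  assumes "AE x in lborel. A x"
  shows "AE x in P. A x"
  unfolding P_eq using assms by (subst AE_density) (auto elim: eventually_mono)

text \<open>Substituting \<open>\<rho>\<close>, which preserves Lebesgue measure, and adding the
  result to the original integral turns the expectation of \<open>g\<close> into an integral against
  a density difference. Comparing expectations becomes a pointwise sign question.\<close>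

lemma
  assumes g: "integrable P g"
    and \<rho>: "orthogonal_transformation \<rho>"
    and anti: "\<And>x. g (\<rho> x) = - g x"
  shows integrable_antisymmetric: "integrable lborel (\<lambda>x. g x * (p x - p (\<rho> x)))"
    and integral_antisymmetric: "2 * (LINT x|P. g x) = (LINT x|lborel. g x * (p x - p (\<rho> x)))"
proof -
  have [measurable]: "\<rho> \<in> borel_measurable borel"
    using \<rho> by (rule orthogonal_transformation_borel_measurable)
  have [measurable]: "g \<in> borel_measurable borel"
    using borel_measurable_integrable[OF g] by simp
  have int: "integrable lborel (\<lambda>x. p x * g x)"
    using g p_nonneg unfolding P_eq by (subst (asm) integrable_density) auto
  then have "integrable (distr lborel borel \<rho>) (\<lambda>x. p x * g x)"
    by (simp add: orthogonal_distr_lborel \<rho>)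
  then have int': "integrable lborel (\<lambda>x. p (\<rho> x) * g x)"
    by (subst (asm) integrable_distr_eq) (simp_all add: anti)
  have "(LINT x|lborel. p x * g x) = (LINT x|distr lborel borel \<rho>. p x * g x)"
    by (simp add: orthogonal_distr_lborel \<rho>)
  also have "\<dots> = - (LINT x|lborel. p (\<rho> x) * g x)"
    by (subst integral_distr) (simp_all add: anti)
  finally have eq: "(LINT x|lborel. p x * g x) = - (LINT x|lborel. p (\<rho> x) * g x)" .
  have split: "g x * (p x - p (\<rho> x)) = p x * g x - p (\<rho> x) * g x" for x
    by (simp add: algebra_simps)
  show "integrable lborel (\<lambda>x. g x * (p x - p (\<rho> x)))"
    unfolding split using int int' by simp
  have "(LINT x|P. g x) = (LINT x|lborel. p x * g x)"
    using p_nonneg unfolding P_eq by (subst integral_density) auto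
  then show "2 * (LINT x|P. g x) = (LINT x|lborel. g x * (p x - p (\<rho> x)))"
    unfolding split using int int' eq by simp
qed

lemma integral_antisymmetric_nonpos:
  assumes "integrable P g" "orthogonal_transformation \<rho>" "\<And>x. g (\<rho> x) = - g x"
    and "\<And>x. g x * (p x - p (\<rho> x)) \<le> 0"
  shows "(LINT x|P. g x) \<le> 0"
proof -
  have "0 \<le> (LINT x|lborel. - (g x * (p x - p (\<rho> x))))"
    by (rule Bochner_Integration.integral_nonneg) (use assms(4) in simp)
  then show ?thesis
    using integral_antisymmetric[OF assms(1-3)] by simp
qed

text \<open>If the integral were 0, a function that is positive almost everywhere would vanish
  almost everywhere, making the whole space a Lebesgue null set.\<close>

lemma integral_antisymmetric_neg:
  assumes "integrable P g" "orthogonal_transformation \<rho>" "\<And>x. g (\<rho> x) = - g x"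
    and neg: "AE x in lborel. g x * (p x - p (\<rho> x)) < 0"
  shows "(LINT x|P. g x) < 0"
proof -
  let ?h = "\<lambda>x. - (g x * (p x - p (\<rho> x)))"
  have int: "integrable lborel ?h"
    using integrable_antisymmetric[OF assms(1-3)] by simp
  have nonneg: "AE x in lborel. 0 \<le> ?h x"
    using neg by eventually_elim simp
  have "(LINT x|lborel. ?h x) \<noteq> 0"
  proof
    assume "(LINT x|lborel. ?h x) = 0"
    then have "AE x in lborel. ?h x = 0"
      using integral_nonneg_eq_0_iff_AE[OF int nonneg] by simp
    with neg have "AE x::'a in lborel. False"
      by eventually_elim simp
    then show False
      by (simp add: AE_iff_null null_sets_def)
  qed
  moreover have "(LINT x|lborel. ?h x) \<ge> 0"
    using nonneg by (rule integral_nonneg_AE)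
  ultimately show ?thesis
    using integral_antisymmetric[OF assms(1-3)] by simp
qed

section \<open>Moving a vector onto the axis lowers the objective\<close>

lemma integrable_pair_kernel: "integrable P (pair_kernel v)"
  by (rule integrable_const_bound[of _ "(norm v)\<^sup>2"]) (auto simp: abs_pair_kernel_le)

definition objective :: "'a \<Rightarrow> real" where
  "objective v = (LINT x|P. pair_kernel v x)"

lemma objective_0: "objective 0 = 0"
  by (simp add: objective_def)

lemma objective_minus: "objective (- v) = objective v"
  by (simp add: objective_def pair_kernel_minus)

lemma objective_axis_less:
  assumes "v \<noteq> norm v *\<^sub>R u" "v \<noteq> - (norm v *\<^sub>R u)"
  shows "objective (norm v *\<^sub>R u) < objective v"
proof -
  define t where "t = norm v"
  define w where "w = t *\<^sub>R u"
  have t: "t > 0" using assms by (auto simp: t_def)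
  have nw: "norm w = norm v" using t norm_u by (simp add: w_def t_def)
  \<comment> \<open>This reflection exchanges \<open>v\<close> and \<open>w\<close> and is
    self-adjoint, so composing with it exchanges the inner products with \<open>v\<close> and
    \<open>w\<close>.\<close>
  define \<rho> where "\<rho> = reflection (v - w)"
  have \<rho>v: "\<rho> v = w" unfolding \<rho>_def by (rule reflection_swap) (simp add: nw)
  have \<rho>w: "\<rho> w = v"
    using reflection_swap[of w v] reflection_minus[of "v - w"] nw by (simp add: \<rho>_def)
  have n\<rho>: "norm (\<rho> x) = norm x" for x by (simp add: \<rho>_def)
  have w\<rho>: "w \<bullet> \<rho> x = v \<bullet> x" and v\<rho>: "v \<bullet> \<rho> x = w \<bullet> x" for x
    using \<rho>v \<rho>w by (simp_all add: \<rho>_def inner_reflection)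
  have "(LINT x|P. pair_kernel w x - pair_kernel v x) < 0"
  proof (rule integral_antisymmetric_neg)
    show "integrable P (\<lambda>x. pair_kernel w x - pair_kernel v x)"
      by (intro Bochner_Integration.integrable_diff integrable_pair_kernel)
    show "orthogonal_transformation \<rho>"
      unfolding \<rho>_def by (rule orthogonal_transformation_reflection)
    show "pair_kernel w (\<rho> x) - pair_kernel v (\<rho> x) = - (pair_kernel w x - pair_kernel v x)" for x
      by (simp add: pair_kernel_eq n\<rho> nw w\<rho> v\<rho>)
    \<comment> \<open>The assumptions say that \<open>v - w\<close> and \<open>v + w\<close> are
      nonzero. Off the two hyperplanes the squared inner products differ, and then the kernel
      difference and the density difference have opposite strict signs.\<close>
    have "AE x in lborel. (v - w) \<bullet> x \<noteq> 0" "AE x in lborel. (v + w) \<bullet> x \<noteq> 0"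
      using assms by (auto intro!: AE_lborel_inner_neq_0 simp: w_def t_def eq_neg_iff_add_eq_0)
    then show "AE x in lborel. (pair_kernel w x - pair_kernel v x) * (p x - p (\<rho> x)) < 0"
    proof eventually_elim
      case (elim x)
      have ux: "(u \<bullet> x)\<^sup>2 = (w \<bullet> x)\<^sup>2 / t\<^sup>2"
        using t by (simp add: w_def power_mult_distrib)
      have u\<rho>: "(u \<bullet> \<rho> x)\<^sup>2 = (v \<bullet> x)\<^sup>2 / t\<^sup>2"
        using t by (simp add: w_def power_mult_distrib flip: w\<rho>)
      have "(v \<bullet> x)\<^sup>2 - (w \<bullet> x)\<^sup>2 = ((v - w) \<bullet> x) * ((v + w) \<bullet> x)"
        by (simp add: power2_eq_square algebra_simps inner_diff_left inner_add_left)
      then have "(v \<bullet> x)\<^sup>2 \<noteq> (w \<bullet> x)\<^sup>2"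
        using elim by auto
      then consider "(v \<bullet> x)\<^sup>2 < (w \<bullet> x)\<^sup>2" | "(w \<bullet> x)\<^sup>2 < (v \<bullet> x)\<^sup>2"
        by linarith
      then show ?case
      proof cases
        case 1
        then have "p (\<rho> x) < p x"
          using t by (intro p_less) (auto simp: n\<rho> ux u\<rho> divide_strict_right_mono)
        moreover have "pair_kernel w x < pair_kernel v x"
          using 1 by (simp add: pair_kernel_less_iff nw)
        ultimately show ?thesis by (simp add: mult_neg_pos)
      next
        case 2
        then have "p x < p (\<rho> x)"
          using t by (intro p_less) (auto simp: n\<rho> ux u\<rho> divide_strict_right_mono)
        moreover have "pair_kernel v x < pair_kernel w x"
          using 2 by (simp add: pair_kernel_less_iff nw)
        ultimately show ?thesis by (simp add: mult_pos_neg)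
      qed
    qed
  qed
  then show ?thesis
    unfolding objective_def w_def[symmetric] t_def[symmetric]
    by (simp add: integrable_pair_kernel)
qed

section \<open>The bilinear form of the sign covariance\<close>

definition sign_form :: "'a \<Rightarrow> 'a \<Rightarrow> real" where
  "sign_form v w = (LINT x|P. (v \<bullet> x) * (w \<bullet> x) / (norm x)\<^sup>2)"

lemma abs_sign_le: "\<bar>(v \<bullet> x) * (w \<bullet> x) / (norm x)\<^sup>2\<bar> \<le> norm v * norm w" for v w x :: 'a
proof (cases "x = 0")
  case False
  have "\<bar>(v \<bullet> x) * (w \<bullet> x)\<bar> \<le> (norm v * norm x) * (norm w * norm x)"
    unfolding abs_mult by (intro mult_mono Cauchy_Schwarz_ineq2) auto
  with False show ?thesis by (simp add: field_simps power2_eq_square)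
qed simp

lemma integrable_sign: "integrable P (\<lambda>x. (v \<bullet> x) * (w \<bullet> x) / (norm x)\<^sup>2)"
  by (rule integrable_const_bound[of _ "norm v * norm w"])
    (simp_all only: real_norm_def abs_sign_le AE_I2, measurable)

text \<open>The reflection exchanging \<open>v\<close> and \<open>u\<close> is used again: where
  \<open>(v \<bullet> x)\<^sup>2\<close> exceeds \<open>(u \<bullet> x)\<^sup>2\<close>, the density
  at \<open>x\<close> is below the one at the reflected point. The result bounds the Rayleigh
  quotient.\<close>

lemma sign_form_le:
  assumes "norm v = 1"
  shows "sign_form v v \<le> sign_form u u"
proof -
  define \<rho> where "\<rho> = reflection (v - u)"
  have \<rho>v: "\<rho> v = u" unfolding \<rho>_def by (rule reflection_swap) (simp add: assms norm_u)
  have \<rho>u: "\<rho> u = v"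
    using reflection_swap[of u v] reflection_minus[of "v - u"] assms norm_u by (simp add: \<rho>_def)
  have n\<rho>: "norm (\<rho> x) = norm x" for x by (simp add: \<rho>_def)
  have u\<rho>: "u \<bullet> \<rho> x = v \<bullet> x" and v\<rho>: "v \<bullet> \<rho> x = u \<bullet> x" for x
    using \<rho>v \<rho>u by (simp_all add: \<rho>_def inner_reflection)
  have "(LINT x|P. (v \<bullet> x) * (v \<bullet> x) / (norm x)\<^sup>2 - (u \<bullet> x) * (u \<bullet> x) / (norm x)\<^sup>2) \<le> 0"
  proof (rule integral_antisymmetric_nonpos)
    show "integrable P (\<lambda>x. (v \<bullet> x) * (v \<bullet> x) / (norm x)\<^sup>2 - (u \<bullet> x) * (u \<bullet> x) / (norm x)\<^sup>2)"
      by (intro Bochner_Integration.integrable_diff integrable_sign)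
    show "orthogonal_transformation \<rho>"
      unfolding \<rho>_def by (rule orthogonal_transformation_reflection)
    fix x
    show "(v \<bullet> \<rho> x) * (v \<bullet> \<rho> x) / (norm (\<rho> x))\<^sup>2 - (u \<bullet> \<rho> x) * (u \<bullet> \<rho> x) / (norm (\<rho> x))\<^sup>2
      = - ((v \<bullet> x) * (v \<bullet> x) / (norm x)\<^sup>2 - (u \<bullet> x) * (u \<bullet> x) / (norm x)\<^sup>2)"
      by (simp add: n\<rho> u\<rho> v\<rho>)
    have diff: "(v \<bullet> x) * (v \<bullet> x) / (norm x)\<^sup>2 - (u \<bullet> x) * (u \<bullet> x) / (norm x)\<^sup>2
        = ((v \<bullet> x)\<^sup>2 - (u \<bullet> x)\<^sup>2) / (norm x)\<^sup>2"
      by (simp add: power2_eq_square diff_divide_distrib)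
    consider "(v \<bullet> x)\<^sup>2 < (u \<bullet> x)\<^sup>2" | "(u \<bullet> x)\<^sup>2 < (v \<bullet> x)\<^sup>2" | "(u \<bullet> x)\<^sup>2 = (v \<bullet> x)\<^sup>2"
      by linarith
    then show "((v \<bullet> x) * (v \<bullet> x) / (norm x)\<^sup>2 - (u \<bullet> x) * (u \<bullet> x) / (norm x)\<^sup>2) * (p x - p (\<rho> x)) \<le> 0"
      unfolding diff
    proof cases
      case 1
      then have "p (\<rho> x) < p x"
        by (intro p_less) (auto simp: n\<rho> u\<rho>)
      with 1 show "((v \<bullet> x)\<^sup>2 - (u \<bullet> x)\<^sup>2) / (norm x)\<^sup>2 * (p x - p (\<rho> x)) \<le> 0"
        by (intro mult_nonpos_nonneg divide_nonpos_nonneg) auto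
    next
      case 2
      then have "p x < p (\<rho> x)"
        by (intro p_less) (auto simp: n\<rho> u\<rho>)
      with 2 show "((v \<bullet> x)\<^sup>2 - (u \<bullet> x)\<^sup>2) / (norm x)\<^sup>2 * (p x - p (\<rho> x)) \<le> 0"
        by (intro mult_nonneg_nonpos divide_nonneg_nonneg) auto
    qed simp
  qed
  then show ?thesis
    by (simp add: sign_form_def integrable_sign)
qed

text \<open>Reflecting along \<open>u\<close> changes the sign of \<open>u \<bullet> x\<close> and
  fixes \<open>w \<bullet> x\<close> and \<open>p\<close>, so the integrand is odd. This will make
  \<open>u\<close> an eigenvector.\<close>

lemma sign_form_orthogonal:
  assumes "u \<bullet> w = 0"
  shows "sign_form u w = 0"
proof -
  let ?\<rho> = "reflection u"
  have uu: "u \<bullet> u = 1" using norm_u by (simp add: dot_square_norm)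
  have u\<rho>: "u \<bullet> ?\<rho> x = - (u \<bullet> x)" and w\<rho>: "w \<bullet> ?\<rho> x = w \<bullet> x" for x
    using assms by (simp_all add: reflection_def inner_diff_right uu inner_commute[of w])
  have "p (?\<rho> x) = p x" for x
    by (rule p_eq) (simp_all add: u\<rho>)
  then show ?thesis
    unfolding sign_form_def
    using integral_antisymmetric[OF integrable_sign[of u w] orthogonal_transformation_reflection[of u]]
    by (simp add: u\<rho> w\<rho>)
qed

end

section \<open>Convexity along the axis\<close>

text \<open>The reverse triangle inequality for two complex numbers with the same imaginary
  part.\<close>

lemma abs_sqrt_sum_squares_diff_le:
  fixes a b c :: real
  shows "\<bar>sqrt (a\<^sup>2 + c\<^sup>2) - sqrt (b\<^sup>2 + c\<^sup>2)\<bar> \<le> \<bar>a - b\<bar>"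
  using norm_triangle_ineq3[of "Complex a c" "Complex b c"] by (simp add: cmod_def)

text \<open>Strict Cauchy-Schwarz for the points \<open>(a, c)\<close> and \<open>(b, c)\<close>:
  the gap is the square of their determinant \<open>c * (a - b)\<close>, nonzero because the line at
  height \<open>c\<close> misses the origin.\<close>

lemma sqrt_sum_squares_midpoint_less:
  fixes a b c :: real
  assumes "a \<noteq> b" "c \<noteq> 0"
  shows "sqrt (((a + b) / 2)\<^sup>2 + c\<^sup>2) < (sqrt (a\<^sup>2 + c\<^sup>2) + sqrt (b\<^sup>2 + c\<^sup>2)) / 2"
proof -
  have "(a * b + c\<^sup>2)\<^sup>2 < (a\<^sup>2 + c\<^sup>2) * (b\<^sup>2 + c\<^sup>2)"
  proof -
    have "(a\<^sup>2 + c\<^sup>2) * (b\<^sup>2 + c\<^sup>2) - (a * b + c\<^sup>2)\<^sup>2 = (c * (a - b))\<^sup>2"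
      by (simp add: power2_eq_square algebra_simps)
    moreover have "(c * (a - b))\<^sup>2 > 0" using assms by simp
    ultimately show ?thesis by linarith
  qed
  then have "a * b + c\<^sup>2 < sqrt (a\<^sup>2 + c\<^sup>2) * sqrt (b\<^sup>2 + c\<^sup>2)"
    by (simp add: real_less_rsqrt flip: real_sqrt_mult)
  moreover have "(sqrt (a\<^sup>2 + c\<^sup>2))\<^sup>2 = a\<^sup>2 + c\<^sup>2" "(sqrt (b\<^sup>2 + c\<^sup>2))\<^sup>2 = b\<^sup>2 + c\<^sup>2"
    by simp_all
  ultimately have "((a + b) / 2)\<^sup>2 + c\<^sup>2 < ((sqrt (a\<^sup>2 + c\<^sup>2) + sqrt (b\<^sup>2 + c\<^sup>2)) / 2)\<^sup>2"
    by (simp add: power_divide power2_sum field_simps)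
  then show ?thesis
    by (rule real_less_lsqrt[rotated]) (simp add: add_nonneg_nonneg)
qed

text \<open>The kernel \<^const>\<open>pair_kernel\<close> at \<open>v = t u\<close>, as a function of \<open>s = t\<^sup>2\<close>, \<open>N = \<parallel>x\<parallel>\<^sup>2\<close> and
  \<open>y = (u \<bullet> x)\<^sup>2\<close>.\<close>

definition axis_kernel :: "real \<Rightarrow> real \<Rightarrow> real \<Rightarrow> real" where
  "axis_kernel N y s = sqrt ((s + (N - 2 * y))\<^sup>2 + (sqrt (4 * y * (N - y)))\<^sup>2) - N"

text \<open>The definition completes the square in \<open>s\<close>; expanding it again gives the
  form that matches \<open>pair_kernel_eq\<close>.\<close>

lemma axis_kernel_eq:
  assumes "0 \<le> y" "y \<le> N"
  shows "axis_kernel N y s = sqrt ((N + s)\<^sup>2 - 4 * s * y) - N"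
proof -
  have "0 \<le> 4 * y * (N - y)" using assms by simp
  then show ?thesis
    by (simp add: axis_kernel_def) (simp add: power2_eq_square algebra_simps)
qed

lemma axis_kernel_0:
  assumes "0 \<le> y" "y \<le> N"
  shows "axis_kernel N y 0 = 0"
  using assms by (simp add: axis_kernel_eq)

lemma abs_axis_kernel_diff_le: "\<bar>axis_kernel N y s - axis_kernel N y s'\<bar> \<le> \<bar>s - s'\<bar>"
  using abs_sqrt_sum_squares_diff_le[of "s + (N - 2 * y)" _ "s' + (N - 2 * y)"]
  by (simp add: axis_kernel_def)

lemma axis_kernel_midpoint_less:
  assumes "0 < y" "y < N" "s \<noteq> s'"
  shows "axis_kernel N y ((s + s') / 2) < (axis_kernel N y s + axis_kernel N y s') / 2"
proof -
  have "sqrt (4 * y * (N - y)) \<noteq> 0" using assms by simp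
  then show ?thesis
    using sqrt_sum_squares_midpoint_less[of "s + (N - 2 * y)" "s' + (N - 2 * y)" "sqrt (4 * y * (N - y))"] assms(3)
    by (simp add: axis_kernel_def add_divide_distrib diff_divide_distrib algebra_simps)
qed

text \<open>The left side is the tangent at \<open>s = 0\<close>. With \<open>z = y / N\<close>, the
  radicand exceeds the square of the tangent shifted by \<open>N\<close> by
  \<open>4 * s\<^sup>2 * (z * (1 - z))\<close>.\<close>

lemma axis_kernel_gt_tangent:
  assumes "0 < y" "y < N" "0 < s"
  shows "s * (1 - 2 * (y / N)) < axis_kernel N y s"
proof -
  define z where "z = y / N"
  have z: "0 < z" "z < 1" "y = N * z" using assms by (simp_all add: z_def)
  have "(N + s)\<^sup>2 - 4 * s * y - (N + s * (1 - 2 * z))\<^sup>2 = 4 * s\<^sup>2 * (z * (1 - z))"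
    unfolding z(3) by (simp add: power2_eq_square algebra_simps)
  moreover have "4 * s\<^sup>2 * (z * (1 - z)) > 0"
    using z assms by simp
  ultimately have "(N + s * (1 - 2 * z))\<^sup>2 < (N + s)\<^sup>2 - 4 * s * y" by linarith
  then have "N + s * (1 - 2 * z) < sqrt ((N + s)\<^sup>2 - 4 * s * y)"
    by (rule real_less_rsqrt)
  then show ?thesis
    using assms by (simp add: axis_kernel_eq z_def)
qed

text \<open>This is \<open>sqrt (N\<^sup>2 + e) \<le> N + e / (2 * N)\<close>, the tangent bound for
  the concave root. The error is of second order in \<open>s\<close>, so the slope at 0 is exactly
  that of the tangent.\<close>

lemma axis_kernel_le_quadratic:
  assumes "0 < y" "y < N" "0 < s"
  shows "axis_kernel N y s \<le> s * (1 - 2 * (y / N)) + s\<^sup>2 / (2 * N)"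
proof -
  define e where "e = 2 * s * (N - 2 * y) + s\<^sup>2"
  have N: "N > 0" using assms by simp
  have D: "(N + s)\<^sup>2 - 4 * s * y = N\<^sup>2 + e"
    by (simp add: e_def power2_eq_square algebra_simps)
  have "4 * s * y \<le> 4 * s * N" using assms by simp
  then have "0 \<le> (N + s)\<^sup>2 - 4 * s * y"
    using zero_le_power2[of "N - s"] by (simp add: power2_sum power2_diff algebra_simps)
  then have e: "- N\<^sup>2 \<le> e" using D by simp
  have "N + e / (2 * N) = (2 * N\<^sup>2 + e) / (2 * N)"
    using N by (simp add: field_simps power2_eq_square)
  moreover have "0 \<le> 2 * N\<^sup>2 + e"
    using e zero_le_power2[of N] by linarith
  ultimately have "0 \<le> N + e / (2 * N)"
    using N by simp
  moreover have "N\<^sup>2 + e \<le> (N + e / (2 * N))\<^sup>2"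
    using N by (simp add: power2_sum)
  ultimately have "sqrt (N\<^sup>2 + e) \<le> N + e / (2 * N)"
    by (simp add: real_le_lsqrt)
  moreover have "e / (2 * N) = s * (1 - 2 * (y / N)) + s\<^sup>2 / (2 * N)"
    using N by (simp add: e_def field_simps)
  ultimately show ?thesis
    using assms D by (simp add: axis_kernel_eq)
qed

section \<open>The objective along the axis\<close>

context spiked_distribution
begin

lemma inner_u_le: "(u \<bullet> x)\<^sup>2 \<le> (norm x)\<^sup>2"
  using Cauchy_Schwarz_ineq[of u x] norm_u by (simp add: power2_norm_eq_inner[symmetric])

definition ray_objective :: "real \<Rightarrow> real" where
  "ray_objective s = (LINT x|P. axis_kernel ((norm x)\<^sup>2) ((u \<bullet> x)\<^sup>2) s)"

lemma borel_measurable_axis_kernel [measurable]: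
  "(\<lambda>x. axis_kernel ((norm x)\<^sup>2) ((u \<bullet> x)\<^sup>2) s) \<in> borel_measurable borel"
  unfolding axis_kernel_def by measurable

text \<open>The kernel is 1-Lipschitz and vanishes at 0. Divided by \<open>s\<close>, this is the
  dominating bound for both limits of the difference quotient.\<close>

lemma abs_axis_kernel_le: "\<bar>axis_kernel ((norm x)\<^sup>2) ((u \<bullet> x)\<^sup>2) s\<bar> \<le> \<bar>s\<bar>"
  using abs_axis_kernel_diff_le[of "(norm x)\<^sup>2" "(u \<bullet> x)\<^sup>2" s 0] inner_u_le by (simp add: axis_kernel_0)

lemma integrable_axis_kernel: "integrable P (\<lambda>x. axis_kernel ((norm x)\<^sup>2) ((u \<bullet> x)\<^sup>2) s)"
  by (rule integrable_const_bound[of _ "\<bar>s\<bar>"]) (auto simp: abs_axis_kernel_le)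

lemma objective_ray: "objective (t *\<^sub>R u) = ray_objective (t\<^sup>2)"
  using norm_u inner_u_le
  by (simp add: objective_def ray_objective_def pair_kernel_eq axis_kernel_eq power_mult_distrib mult.assoc)

lemma ray_objective_0: "ray_objective 0 = 0"
  by (simp add: ray_objective_def axis_kernel_0 inner_u_le)

text \<open>Dimension at least 2 provides a nonzero \<open>w\<close> orthogonal to \<open>u\<close>;
  a point with \<open>w \<bullet> x \<noteq> 0\<close> is off the line of \<open>u\<close>, so
  Cauchy-Schwarz is strict there.\<close>

lemma AE_generic:
  assumes "2 \<le> DIM('a)"
  shows "AE x in P. 0 < (u \<bullet> x)\<^sup>2 \<and> (u \<bullet> x)\<^sup>2 < (norm x)\<^sup>2"
proof -
  obtain w where w: "w \<noteq> 0" "orthogonal u w"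
    using vector_choose_size orthogonal_to_vector_exists assms by blast
  have "u \<noteq> 0" using norm_u by auto
  then have "AE x in lborel. u \<bullet> x \<noteq> 0" "AE x in lborel. w \<bullet> x \<noteq> 0"
    using w by (simp_all add: AE_lborel_inner_neq_0)
  then have "AE x in lborel. 0 < (u \<bullet> x)\<^sup>2 \<and> (u \<bullet> x)\<^sup>2 < (norm x)\<^sup>2"
  proof eventually_elim
    case (elim x)
    have "(norm (x - (u \<bullet> x) *\<^sub>R u))\<^sup>2 = (norm x)\<^sup>2 - (u \<bullet> x)\<^sup>2"
    proof -
      have "u \<bullet> u = 1" using norm_u by (simp add: dot_square_norm)
      then show ?thesis
        unfolding power2_norm_eq_inner
        by (simp add: inner_diff_left inner_diff_right inner_commute power2_eq_square algebra_simps)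
    qed
    moreover have "x - (u \<bullet> x) *\<^sub>R u \<noteq> 0"
    proof
      assume "x - (u \<bullet> x) *\<^sub>R u = 0"
      then have "w \<bullet> x = (u \<bullet> x) * (w \<bullet> u)"
        by (metis eq_iff_diff_eq_0 inner_scaleR_right)
      then show False
        using w elim by (simp add: orthogonal_def inner_commute)
    qed
    ultimately have "(norm x)\<^sup>2 - (u \<bullet> x)\<^sup>2 > 0"
      by (metis zero_less_norm_iff zero_less_power)
    then show ?case using elim by simp
  qed
  then show ?thesis by (rule AE_P)
qed

lemma ray_objective_lipschitz: "\<bar>ray_objective s - ray_objective s'\<bar> \<le> \<bar>s - s'\<bar>"
proof -
  let ?q = "\<lambda>x s. axis_kernel ((norm x)\<^sup>2) ((u \<bullet> x)\<^sup>2) s"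
  have "\<bar>ray_objective s - ray_objective s'\<bar> = \<bar>LINT x|P. ?q x s - ?q x s'\<bar>"
    by (simp add: ray_objective_def integrable_axis_kernel)
  also have "\<dots> \<le> (LINT x|P. \<bar>?q x s - ?q x s'\<bar>)"
    by (rule integral_abs_bound)
  also have "\<dots> \<le> (LINT x|P. \<bar>s - s'\<bar>)"
    by (intro integral_mono integrable_abs Bochner_Integration.integrable_diff integrable_axis_kernel
        abs_axis_kernel_diff_le integrable_const)
  also have "\<dots> = \<bar>s - s'\<bar>"
    by (simp add: prob_space)
  finally show ?thesis .
qed

lemma continuous_on_ray_objective: "continuous_on S ray_objective"
proof (rule continuous_at_imp_continuous_on, intro ballI)
  fix s
  have "((\<lambda>s'. ray_objective s' - ray_objective s) \<longlongrightarrow> 0) (at s)"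
  proof (rule Lim_null_comparison)
    show "\<forall>\<^sub>F s' in at s. norm (ray_objective s' - ray_objective s) \<le> \<bar>s' - s\<bar>"
      by (simp add: ray_objective_lipschitz)
    show "((\<lambda>s'. \<bar>s' - s\<bar>) \<longlongrightarrow> 0) (at s)"
      by (auto intro!: tendsto_eq_intros)
  qed
  then show "isCont ray_objective s"
    by (simp add: isCont_def LIM_zero_iff)
qed

lemma ray_objective_midpoint_less:
  assumes "2 \<le> DIM('a)" "s \<noteq> s'"
  shows "ray_objective ((s + s') / 2) < (ray_objective s + ray_objective s') / 2"
proof -
  let ?q = "\<lambda>x s. axis_kernel ((norm x)\<^sup>2) ((u \<bullet> x)\<^sup>2) s"
  have "ray_objective ((s + s') / 2) < (LINT x|P. (?q x s + ?q x s') / 2)"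
    unfolding ray_objective_def
  proof (rule integral_less_AE_space)
    show "AE x in P. ?q x ((s + s') / 2) < (?q x s + ?q x s') / 2"
      using AE_generic[OF assms(1)] by eventually_elim (simp only: axis_kernel_midpoint_less assms(2) not_False_eq_True)
  qed (simp_all add: integrable_axis_kernel emeasure_space_1)
  then show ?thesis
    by (simp add: ray_objective_def integrable_axis_kernel)
qed

text \<open>The pointwise tangent inequality integrated; the ratio \<open>y / N\<close> has
  expectation \<open>sign_form u u\<close>.\<close>

lemma ray_objective_gt_tangent:
  assumes "2 \<le> DIM('a)" "0 < s"
  shows "s * (1 - 2 * sign_form u u) < ray_objective s"
proof -
  let ?z = "\<lambda>x. (u \<bullet> x) * (u \<bullet> x) / (norm x)\<^sup>2"
  have "(LINT x|P. s * (1 - 2 * ?z x)) < ray_objective s"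
    unfolding ray_objective_def
  proof (rule integral_less_AE_space)
    show "integrable P (\<lambda>x. s * (1 - 2 * ?z x))"
      by (intro integrable_mult_right Bochner_Integration.integrable_diff integrable_const integrable_sign)
    show "AE x in P. s * (1 - 2 * ?z x) < axis_kernel ((norm x)\<^sup>2) ((u \<bullet> x)\<^sup>2) s"
      using AE_generic[OF assms(1)]
      by eventually_elim (use axis_kernel_gt_tangent assms(2) in \<open>simp add: power2_eq_square\<close>)
  qed (simp_all add: integrable_axis_kernel emeasure_space_1)
  moreover have "(LINT x|P. s * (1 - 2 * ?z x)) = s * (1 - 2 * sign_form u u)"
    unfolding integral_mult_right_zero
    by (subst Bochner_Integration.integral_diff)
      (simp_all only: integrable_const integrable_mult_right integrable_sign integral_mult_right_zero
        sign_form_def, simp add: prob_space)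
  ultimately show ?thesis by (simp only:)
qed

text \<open>Dominated convergence, with the quotient between \<open>1 - 2 * N / s\<close> and 1. The
  objective is thus positive far out, which confines the search for a minimum to a compact
  interval.\<close>

lemma ray_objective_at_top: "((\<lambda>s. ray_objective s / s) \<longlongrightarrow> 1) at_top"
proof -
  let ?q = "\<lambda>s x. axis_kernel ((norm x)\<^sup>2) ((u \<bullet> x)\<^sup>2) s"
  have "((\<lambda>s. LINT x|P. ?q s x / s) \<longlongrightarrow> (LINT x|P. 1)) at_top"
  proof (rule integral_dominated_convergence_at_top[where w="\<lambda>_. 1"])
    show "\<forall>\<^sub>F s in at_top. AE x in P. norm (?q s x / s) \<le> 1"
      using eventually_gt_at_top[of 0]
    proof eventually_elim
      case (elim s)
      show ?case
        using abs_axis_kernel_le[of _ s] elim by (intro AE_I2) (simp add: divide_le_eq)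
    qed
    show "AE x in P. ((\<lambda>s. ?q s x / s) \<longlongrightarrow> 1) at_top"
    proof (rule AE_I2)
      fix x :: 'a
      define N where "N = (norm x)\<^sup>2"
      define y where "y = (u \<bullet> x)\<^sup>2"
      have y: "0 \<le> y" "y \<le> N" by (simp_all add: y_def N_def inner_u_le)
      show "((\<lambda>s. ?q s x / s) \<longlongrightarrow> 1) at_top"
        unfolding N_def[symmetric] y_def[symmetric]
      proof (rule tendsto_sandwich)
        show "\<forall>\<^sub>F s in at_top. 1 - 2 * N / s \<le> axis_kernel N y s / s"
          using eventually_gt_at_top[of 0]
        proof eventually_elim
          case (elim s)
          have "(s - N)\<^sup>2 \<le> (N + s)\<^sup>2 - 4 * s * y"
            using mult_left_mono[OF y(2), of "4 * s"] elim by (simp add: power2_sum power2_diff algebra_simps)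
          then have "s - N \<le> sqrt ((N + s)\<^sup>2 - 4 * s * y)"
            by (rule real_le_rsqrt)
          then have "s - 2 * N \<le> axis_kernel N y s"
            using y by (simp add: axis_kernel_eq)
          then have "(s - 2 * N) / s \<le> axis_kernel N y s / s"
            using elim by (simp add: divide_right_mono)
          then show ?case
            using elim by (simp add: diff_divide_distrib)
        qed
        show "\<forall>\<^sub>F s in at_top. axis_kernel N y s / s \<le> 1"
          using eventually_gt_at_top[of 0]
        proof eventually_elim
          case (elim s)
          then show ?case
            using abs_axis_kernel_le[of x s] by (simp add: N_def y_def divide_le_eq)
        qed
        show "((\<lambda>s. 1 - 2 * N / s) \<longlongrightarrow> 1) at_top"
          using tendsto_diff[OF tendsto_const tendsto_divide_0[OF tendsto_const
              filterlim_at_top_imp_at_infinity[OF filterlim_ident]], of 1 "2 * N"] by simp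
      qed simp
    qed
  qed simp_all
  then show ?thesis
    by (simp add: ray_objective_def prob_space)
qed

text \<open>The quotient is squeezed between the tangent and the quadratic bound, then dominated
  convergence applies. A sequence tending to 0 is enough, since the limit serves to find one point
  of negative value.\<close>

lemma ray_objective_at_0:
  assumes "2 \<le> DIM('a)"
  shows "(\<lambda>n. ray_objective (1 / real (Suc n)) / (1 / real (Suc n))) \<longlonglongrightarrow> 1 - 2 * sign_form u u"
proof -
  let ?q = "\<lambda>s x. axis_kernel ((norm x)\<^sup>2) ((u \<bullet> x)\<^sup>2) s"
  let ?z = "\<lambda>x. (u \<bullet> x) * (u \<bullet> x) / (norm x)\<^sup>2"
  have "(\<lambda>n. LINT x|P. ?q (1 / real (Suc n)) x / (1 / real (Suc n))) \<longlonglongrightarrow> (LINT x|P. 1 - 2 * ?z x)"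
  proof (rule integral_dominated_convergence[where w="\<lambda>_. 1"])
    show "AE x in P. norm (?q (1 / real (Suc n)) x / (1 / real (Suc n))) \<le> 1" for n
      using abs_axis_kernel_le[of _ "1 / real (Suc n)"]
      by (intro AE_I2) (simp only: real_norm_def abs_divide divide_le_eq_1, simp)
    show "AE x in P. (\<lambda>n. ?q (1 / real (Suc n)) x / (1 / real (Suc n))) \<longlonglongrightarrow> 1 - 2 * ?z x"
      using AE_generic[OF assms]
    proof eventually_elim
      case (elim x)
      define N where "N = (norm x)\<^sup>2"
      define y where "y = (u \<bullet> x)\<^sup>2"
      have y: "0 < y" "y < N" using elim by (simp_all add: y_def N_def)
      have z: "?z x = y / N" by (simp add: y_def N_def power2_eq_square)
      show ?case
        unfolding z unfolding N_def[symmetric] y_def[symmetric]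
      proof (rule tendsto_sandwich)
        show "\<forall>\<^sub>F n in sequentially. 1 - 2 * (y / N) \<le> axis_kernel N y (1 / real (Suc n)) / (1 / real (Suc n))"
        proof (intro always_eventually allI)
          fix n
          define s where "s = 1 / real (Suc n)"
          have s: "s > 0" by (simp add: s_def)
          have "1 - 2 * (y / N) \<le> axis_kernel N y s / s"
            using axis_kernel_gt_tangent[OF y s] s by (simp only: pos_le_divide_eq mult.commute[of _ s] less_imp_le)
          then show "1 - 2 * (y / N) \<le> axis_kernel N y (1 / real (Suc n)) / (1 / real (Suc n))"
            by (simp only: s_def)
        qed
        show "\<forall>\<^sub>F n in sequentially. axis_kernel N y (1 / real (Suc n)) / (1 / real (Suc n))
            \<le> 1 - 2 * (y / N) + 1 / real (Suc n) / (2 * N)"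
        proof (intro always_eventually allI)
          fix n
          define s where "s = 1 / real (Suc n)"
          have s: "s > 0" by (simp add: s_def)
          have "axis_kernel N y s / s \<le> (s * (1 - 2 * (y / N)) + s\<^sup>2 / (2 * N)) / s"
            using axis_kernel_le_quadratic[OF y s] s by (simp add: divide_right_mono)
          also have "\<dots> = 1 - 2 * (y / N) + s / (2 * N)"
            using s by (simp add: add_divide_distrib power2_eq_square)
          finally show "axis_kernel N y (1 / real (Suc n)) / (1 / real (Suc n))
            \<le> 1 - 2 * (y / N) + 1 / real (Suc n) / (2 * N)"
            by (simp only: s_def)
        qed
        show "(\<lambda>n. 1 - 2 * (y / N) + 1 / real (Suc n) / (2 * N)) \<longlonglongrightarrow> 1 - 2 * (y / N)"
          using tendsto_add[OF tendsto_const tendsto_divide[OF LIMSEQ_inverse_real_of_nat tendsto_const[of "2 * N"]],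
              of "1 - 2 * (y / N)"] y by (simp add: inverse_eq_divide)
      qed simp
    qed
  qed simp_all
  moreover have "(LINT x|P. 1 - 2 * ?z x) = 1 - 2 * sign_form u u"
    by (subst Bochner_Integration.integral_diff)
      (simp_all only: integrable_const integrable_mult_right integrable_sign integral_mult_right_zero
        sign_form_def, simp add: prob_space)
  ultimately show ?thesis
    by (simp add: ray_objective_def)
qed

section \<open>The minimum along the axis\<close>

lemma ray_objective_neg:
  assumes "2 \<le> DIM('a)" "sign_form u u > 1 / 2"
  obtains s where "0 < s" "ray_objective s < 0"
proof -
  have "1 - 2 * sign_form u u < 0" using assms by simp
  then have "\<forall>\<^sub>F n in sequentially. ray_objective (1 / real (Suc n)) / (1 / real (Suc n)) < 0"
    using order_tendstoD(2)[OF ray_objective_at_0[OF assms(1)]] by blast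
  then obtain n where "ray_objective (1 / real (Suc n)) / (1 / real (Suc n)) < 0"
    using eventually_happens'[OF sequentially_bot] by blast
  then have "ray_objective (1 / real (Suc n)) < 0"
    by (simp add: mult_less_0_iff)
  then show thesis
    by (intro that[of "1 / real (Suc n)"]) auto
qed

lemma ray_objective_minimizer:
  assumes "2 \<le> DIM('a)" "sign_form u u > 1 / 2"
  shows "\<exists>s>0. \<forall>s'\<ge>0. s' \<noteq> s \<longrightarrow> ray_objective s < ray_objective s'"
proof -
  obtain s1 where s1: "0 < s1" "ray_objective s1 < 0"
    using ray_objective_neg[OF assms] .
  have "\<forall>\<^sub>F s in at_top. 0 < ray_objective s / s"
    using order_tendstoD(1)[OF ray_objective_at_top, of 0] by simp
  then obtain s0 where s0: "\<And>s. s \<ge> s0 \<Longrightarrow> 0 < ray_objective s / s"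
    by (auto simp: eventually_at_top_linorder)
  \<comment> \<open>Beyond \<open>s0\<close> the values are positive. Including \<open>s1\<close>
    makes the minimum over \<open>{0..b}\<close> negative, hence global on the half-line and not
    attained at 0.\<close>
  define b where "b = max s0 s1"
  have "\<exists>s\<in>{0..b}. \<forall>s'\<in>{0..b}. ray_objective s \<le> ray_objective s'"
    using s1 by (intro continuous_attains_inf continuous_on_ray_objective) (auto simp: b_def)
  then obtain s where s: "0 \<le> s" "\<And>s'. 0 \<le> s' \<Longrightarrow> s' \<le> b \<Longrightarrow> ray_objective s \<le> ray_objective s'"
    by auto
  have neg: "ray_objective s < 0"
    using s(2)[of s1] s1 by (simp add: b_def)
  have le: "ray_objective s \<le> ray_objective s'" if "0 \<le> s'" for s'
  proof (cases "s' \<le> b")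
    case False
    then have "0 < ray_objective s' / s'" "0 < s'"
      using s0[of s'] s1 by (auto simp: b_def)
    then show ?thesis using neg by (simp add: zero_less_divide_iff)
  qed (use s that in simp)
  have "s \<noteq> 0" using neg ray_objective_0 by auto
  show ?thesis
  proof (intro exI conjI allI impI)
    show "0 < s" using s \<open>s \<noteq> 0\<close> by simp
    fix s' :: real assume s': "0 \<le> s'" "s' \<noteq> s"
    show "ray_objective s < ray_objective s'"
    proof (rule ccontr)
      \<comment> \<open>Strict midpoint convexity would then push the midpoint below the
        minimum.\<close>
      assume "\<not> ray_objective s < ray_objective s'"
      then have "ray_objective ((s + s') / 2) < ray_objective s"
        using ray_objective_midpoint_less[OF assms(1), of s s'] s' by simp
      moreover have "ray_objective s \<le> ray_objective ((s + s') / 2)"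
        using s s' by (intro le) simp
      ultimately show False by simp
    qed
  qed
qed

section \<open>Minimizers over the whole space\<close>

lemma objective_ge_ray: "ray_objective ((norm v)\<^sup>2) \<le> objective v"
  and objective_eq_ray: "objective v = ray_objective ((norm v)\<^sup>2) \<Longrightarrow> v = norm v *\<^sub>R u \<or> v = - (norm v *\<^sub>R u)"
  using objective_axis_less[of v] objective_ray[of "norm v"] objective_minus[of "norm v *\<^sub>R u"]
  by (metis less_irrefl less_imp_le order_refl)+

text \<open>A minimizer must have squared norm equal to the unique minimizing \<open>s\<close> and
  must attain the ray value there, which happens only on the line of \<open>u\<close>.\<close>

lemma minimizers_objective_spiked:
  assumes "2 \<le> DIM('a)" "sign_form u u > 1 / 2"
  shows "\<exists>\<psi>>0. minimizers objective = {\<psi> *\<^sub>R u, - (\<psi> *\<^sub>R u)}"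
proof -
  obtain s where s: "0 < s" "\<And>s'. 0 \<le> s' \<Longrightarrow> s' \<noteq> s \<Longrightarrow> ray_objective s < ray_objective s'"
    using ray_objective_minimizer[OF assms] by blast
  have le: "ray_objective s \<le> objective v" for v
    using s(2)[of "(norm v)\<^sup>2"] objective_ge_ray[of v] by (cases "(norm v)\<^sup>2 = s") auto
  have ray: "objective (sqrt s *\<^sub>R u) = ray_objective s"
    using s(1) by (simp add: objective_ray)
  have "v \<in> minimizers objective \<longleftrightarrow> objective v = ray_objective s" for v
    unfolding minimizers_def is_arg_min_linorder using le ray by (auto intro: antisym) (metis antisym)
  moreover have "objective v = ray_objective s \<longleftrightarrow> v = sqrt s *\<^sub>R u \<or> v = - (sqrt s *\<^sub>R u)" for v
  proof
    assume eq: "objective v = ray_objective s"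
    have "(norm v)\<^sup>2 = s"
    proof (rule ccontr)
      assume "(norm v)\<^sup>2 \<noteq> s"
      then have "ray_objective s < ray_objective ((norm v)\<^sup>2)" by (intro s(2)) auto
      then show False using objective_ge_ray[of v] eq by simp
    qed
    then have "norm v = sqrt s" "objective v = ray_objective ((norm v)\<^sup>2)"
      using eq by (auto simp: real_sqrt_unique)
    then show "v = sqrt s *\<^sub>R u \<or> v = - (sqrt s *\<^sub>R u)"
      using objective_eq_ray[of v] by simp
  qed (auto simp: ray objective_minus)
  ultimately have "minimizers objective = {sqrt s *\<^sub>R u, - (sqrt s *\<^sub>R u)}"
    by blast
  then show ?thesis
    using s(1) by (intro exI[of _ "sqrt s"]) simp
qed

lemma minimizers_objective_unspiked:
  assumes "2 \<le> DIM('a)" "sign_form u u \<le> 1 / 2"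
  shows "minimizers objective = {0}"
proof -
  have pos: "0 < objective v" if "v \<noteq> 0" for v
  proof -
    have "0 \<le> (norm v)\<^sup>2 * (1 - 2 * sign_form u u)"
      using assms(2) by simp
    also have "\<dots> < ray_objective ((norm v)\<^sup>2)"
      using that by (intro ray_objective_gt_tangent[OF assms(1)]) simp
    also have "\<dots> \<le> objective v" by (rule objective_ge_ray)
    finally show ?thesis .
  qed
  show ?thesis
    unfolding minimizers_def is_arg_min_linorder
  proof (intro equalityI subsetI)
    fix v assume "v \<in> {v. True \<and> (\<forall>w. True \<longrightarrow> objective v \<le> objective w)}"
    then have "objective v \<le> objective 0" by blast
    then show "v \<in> {0}" using pos[of v] objective_0 by (cases "v = 0") auto
  next
    fix v :: 'a assume "v \<in> {0}"
    moreover have "0 \<le> objective w" for w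
      using pos[of w] objective_0 by (cases "w = 0") auto
    ultimately show "v \<in> {v. True \<and> (\<forall>w. True \<longrightarrow> objective v \<le> objective w)}"
      by (simp add: objective_0)
  qed
qed

end

section \<open>Elliptical distributions\<close>

lemma spherical_orthogonal_transformation:
  assumes "spherical Q" "orthogonal_transformation f"
  shows "distr Q borel f = Q"
proof -
  have "orthogonal_matrix (matrix f)" "linear f"
    using assms(2) by (simp_all add: orthogonal_transformation_matrix)
  moreover have "f = (\<lambda>z. matrix f *v z)"
    using \<open>linear f\<close> by (simp add: matrix_works)
  ultimately show ?thesis
    using assms(1) unfolding spherical_def by metis
qed

text \<open>A rotation invariant measure \<open>M\<close> with an explicit density is built to have
  the radial law of \<open>Q\<close>; radial laws determine such measures, so
  \<open>Q = M\<close>.\<close>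

lemma spherical_density:
  fixes Q :: "(real ^ 'n) measure"
  assumes "prob_space Q" and sets [measurable_cong]: "sets Q = sets borel"
    and "spherical Q" "radial_density Q f"
  obtains c where "c > 0"
    "(\<lambda>r. f r * indicator {0<..} r / r ^ (CARD('n) - 1)) \<in> borel_measurable borel"
    "Q = density lborel (\<lambda>z. ennreal (c * (f (norm z) * indicator {0<..} (norm z) / norm z ^ (CARD('n) - 1))))"
proof -
  interpret Q: prob_space Q by fact
  define F where "F r = f r * indicator {0<..} r" for r :: real
  have F: "0 \<le> F r" for r
    using \<open>radial_density Q f\<close> by (auto simp: F_def radial_density_def indicator_def less_imp_le)
  have dist: "distributed Q lborel norm (\<lambda>r. ennreal (F r))"
    using \<open>radial_density Q f\<close> by (simp add: F_def radial_density_def)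
  \<comment> \<open>\<open>distributed\<close> yields measurability after \<open>ennreal\<close>;
    since \<open>F\<close> is nonnegative, \<open>enn2real\<close> recovers \<open>F\<close>
    itself.\<close>
  have "(\<lambda>r. enn2real (ennreal (F r))) \<in> borel_measurable borel"
    using distributed_borel_measurable[OF dist] by measurable
  then have [measurable]: "F \<in> borel_measurable borel"
    using F by simp
  let ?n = "CARD('n)"
  \<comment> \<open>The surface area of the unit sphere: \<open>a * r ^ (?n - 1)\<close> is the
    radial density of Lebesgue measure, which \<open>g\<close> divides out.\<close>
  define a where "a = real ?n * unit_ball_vol (real ?n)"
  have a: "a > 0"
    unfolding a_def by (intro mult_pos_pos unit_ball_vol_pos) auto
  define g where "g r = ennreal (1 / a * (F r / r ^ (?n - 1)))" for r
  have [measurable]: "g \<in> borel_measurable borel"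
    unfolding g_def by measurable
  define M where "M = density lborel (\<lambda>z :: real ^ 'n. g (norm z))"
  have setsM: "sets M = sets borel" by (simp add: M_def)
  have "distr Q borel norm = distr Q lborel norm"
    by (rule distr_cong) auto
  also have "\<dots> = density lborel (\<lambda>r. ennreal (F r))"
    using distributed_distr_eq_density[OF dist] .
  finally have normQ: "distr Q borel norm = density lborel (\<lambda>r. ennreal (F r))" .
  have "distr M borel norm = density (distr lborel borel (norm :: real ^ 'n \<Rightarrow> real)) g"
    unfolding M_def by (rule density_distr[symmetric]) auto
  also have "\<dots> = density lborel (\<lambda>r. ennreal (F r))"
    unfolding distr_norm_lborel
  proof (subst density_density_eq)
    show "density lborel (\<lambda>r. ennreal (real DIM(real ^ 'n) * unit_ball_vol (real DIM(real ^ 'n)) *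
        r ^ (DIM(real ^ 'n) - 1)) * indicator {0<..} r * g r) = density lborel (\<lambda>r. ennreal (F r))"
    proof (rule density_cong)
      show "AE r in lborel. ennreal (real DIM(real ^ 'n) * unit_ball_vol (real DIM(real ^ 'n)) *
        r ^ (DIM(real ^ 'n) - 1)) * indicator {0<..} r * g r = ennreal (F r)"
      proof (rule AE_I2)
        fix r :: real
        show "ennreal (real DIM(real ^ 'n) * unit_ball_vol (real DIM(real ^ 'n)) *
          r ^ (DIM(real ^ 'n) - 1)) * indicator {0<..} r * g r = ennreal (F r)"
        proof (cases "r > 0")
          case True
          then show ?thesis
            using a F[of r] by (simp add: g_def a_def[symmetric] flip: ennreal_mult)
        next
          case False
          then show ?thesis by (simp add: F_def)
        qed
      qed
    qed measurable
  qed measurable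
  finally have normM: "distr M borel norm = density lborel (\<lambda>r. ennreal (F r))" .
  have "emeasure M (space M) = emeasure (distr M borel norm) UNIV"
    by (subst emeasure_distr) (auto simp: M_def)
  also have "\<dots> = emeasure Q (space Q)"
    unfolding normM normQ[symmetric] by (subst emeasure_distr) auto
  finally have finM: "finite_measure M"
    by (intro finite_measureI) (simp add: Q.emeasure_space_1)
  have rotM: "distr M borel h = M" if h: "orthogonal_transformation h" for h
  proof -
    note [measurable] = orthogonal_transformation_borel_measurable[OF h]
    have "distr M borel h = distr (density lborel (\<lambda>z. g (norm (h z)))) borel h"
      by (simp add: M_def orthogonal_transformation_norm[OF h])
    also have "\<dots> = density (distr lborel borel h) (\<lambda>z. g (norm z))"
      by (rule density_distr[symmetric]) auto
    finally show ?thesis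
      by (simp add: orthogonal_distr_lborel[OF h] M_def)
  qed
  have "Q = M"
    by (rule radial_measure_eqI[OF Q.finite_measure_axioms finM sets setsM
          spherical_orthogonal_transformation[OF \<open>spherical Q\<close>] rotM])
      (simp_all add: normQ normM)
  moreover have "(\<lambda>r. F r / r ^ (?n - 1)) \<in> borel_measurable borel" by measurable
  ultimately show thesis
    using that[of "1 / a"] a by (simp add: M_def g_def F_def)
qed

text \<open>Up to a constant, the density of \<open>P\<close> at \<open>x\<close> is
  \<open>h\<close> at the norm of the preimage of \<open>x\<close>. On a sphere the preimage gets
  shorter as \<open>(column k U \<bullet> x)\<^sup>2\<close> grows, because \<open>L\<close>
  stretches coordinate \<open>k\<close> most, and \<open>h\<close> is strictly decreasing.\<close>

lemma elliptical_class_spiked_distribution: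
  fixes U L :: "real ^ 'n ^ 'n"
  assumes U: "orthogonal_matrix U" and L: "L \<in> spiked_scatter k" and P: "P \<in> elliptical_class U L"
  shows "\<exists>p. spiked_distribution P (column k U) p"
proof -
  let ?n = "CARD('n)"
  obtain s l where sl: "s > 0" "l > 1" and Ldef: "L = s *\<^sub>R diagonal_matrix (\<lambda>i. if i = k then l else 1)"
    using L by (auto simp: spiked_scatter_def)
  obtain Q f where Pdef: "P = distr Q borel (\<lambda>z. (U ** L) *v z)"
    and Q: "prob_space Q" "sets Q = sets borel" "spherical Q" "radial_density Q f"
    and anti: "strict_antimono_on {0<..} (\<lambda>r. f r / r ^ (?n - 1))"
    using P by (auto simp: elliptical_class_def)
  define T where "T z = (U ** L) *v z" for z
  have Lz: "(L *v z) $ i = s * (if i = k then l else 1) * z $ i" for z i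
  proof -
    have "(L *v z) $ i = (\<Sum>j\<in>UNIV. if i = j then s * (if i = k then l else 1) * z $ j else 0)"
      unfolding Ldef matrix_vector_mult_def diagonal_matrix_def
      by (simp only: vec_lambda_beta vector_scaleR_component) (intro sum.cong, auto)
    then show ?thesis by simp
  qed
  have normL: "(norm (L *v z))\<^sup>2 = s\<^sup>2 * ((norm z)\<^sup>2 + (l\<^sup>2 - 1) * (z $ k)\<^sup>2)" for z
  proof -
    have "(norm (L *v z))\<^sup>2 = (\<Sum>i\<in>UNIV. (s * (if i = k then l else 1) * z $ i)\<^sup>2)"
      by (simp add: norm_vec_def L2_set_def Lz sum_nonneg)
    also have "\<dots> = (\<Sum>i\<in>UNIV. s\<^sup>2 * (z $ i)\<^sup>2 + (if i = k then s\<^sup>2 * (l\<^sup>2 - 1) * (z $ i)\<^sup>2 else 0))"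
      by (intro sum.cong) (auto simp: algebra_simps)
    also have "\<dots> = s\<^sup>2 * (norm z)\<^sup>2 + s\<^sup>2 * (l\<^sup>2 - 1) * (z $ k)\<^sup>2"
      by (simp add: sum.distrib norm_vec_def L2_set_def sum_nonneg flip: sum_distrib_left)
    finally show ?thesis by (simp add: algebra_simps)
  qed
  have orthU: "orthogonal_transformation ((*v) U)"
    using U by (simp add: orthogonal_transformation_matrix)
  have TU: "T z = U *v (L *v z)" for z
    by (simp add: T_def matrix_vector_mul_assoc)
  have normT: "(norm (T z))\<^sup>2 = s\<^sup>2 * ((norm z)\<^sup>2 + (l\<^sup>2 - 1) * (z $ k)\<^sup>2)" for z
    unfolding TU orthogonal_transformation_norm[OF orthU] by (rule normL)
  have colT: "column k U \<bullet> T z = s * l * z $ k" for z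
  proof -
    have "column k U \<bullet> T z = (U *v axis k 1) \<bullet> (U *v (L *v z))"
      by (simp add: TU matrix_vector_mult_basis)
    also have "\<dots> = axis k 1 \<bullet> (L *v z)"
      using orthU by (simp add: orthogonal_transformation_def)
    finally show ?thesis by (simp add: inner_axis' Lz)
  qed
  have linT: "linear T"
    unfolding T_def by simp
  have "z = 0" if "T z = 0" for z
  proof -
    have "(norm z)\<^sup>2 + (l\<^sup>2 - 1) * (z $ k)\<^sup>2 = 0"
      using normT[of z] that sl by simp
    moreover have "(l\<^sup>2 - 1) * (z $ k)\<^sup>2 \<ge> 0"
      using sl by (intro mult_nonneg_nonneg) auto
    ultimately have "(norm z)\<^sup>2 \<le> 0" by linarith
    then show "z = 0" by simp
  qed
  then have "inj T"
    using linT by (simp add: linear_injective_0)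
  then have bijT: "bij T"
    using linT by (simp add: bij_def linear_injective_imp_surjective)
  define S where "S = inv T"
  have ST: "S (T z) = z" and TS: "T (S x) = x" for x z
    using bijT by (simp_all add: S_def bij_is_inj bij_is_surj surj_f_inv_f)
  have normS: "(norm (S x))\<^sup>2 = ((norm x)\<^sup>2 - (l\<^sup>2 - 1) / l\<^sup>2 * (column k U \<bullet> x)\<^sup>2) / s\<^sup>2" for x
  proof -
    have "(l\<^sup>2 - 1) / l\<^sup>2 * (column k U \<bullet> x)\<^sup>2 = s\<^sup>2 * ((l\<^sup>2 - 1) * (S x $ k)\<^sup>2)"
      using colT[of "S x"] sl by (simp add: TS power_mult_distrib)
    moreover have "(norm x)\<^sup>2 = s\<^sup>2 * ((norm (S x))\<^sup>2 + (l\<^sup>2 - 1) * (S x $ k)\<^sup>2)"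
      using normT[of "S x"] by (simp add: TS)
    ultimately show ?thesis
      using sl by (simp add: distrib_left)
  qed
  have "linear S"
    using linT bijT by (simp add: S_def inj_linear_imp_inv_linear bij_is_inj)
  then have [measurable]: "S \<in> borel_measurable borel"
    by (rule linear_borel_measurable)
  have T_meas [measurable]: "T \<in> borel_measurable borel"
    using linT by (rule linear_borel_measurable)
  define h where "h r = f r * indicator {0<..} r / r ^ (?n - 1)" for r
  obtain c where c: "c > 0" and h[measurable]: "h \<in> borel_measurable borel"
    and Qd: "Q = density lborel (\<lambda>z. ennreal (c * h (norm z)))"
    unfolding h_def using spherical_density[OF Q] by blast
  obtain d where d: "d > 0" and Td: "distr lborel borel T = density lborel (\<lambda>_. ennreal d)"
    using linear_distr_lborel[OF linT bijT] by blast
  have h_nonneg: "0 \<le> h r" for r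
    using Q(4) by (auto simp: h_def radial_density_def indicator_def less_imp_le)
  have h_anti: "h r < h r'" if "0 < r'" "r' < r" for r r'
    using that anti by (auto simp: h_def monotone_on_def)
  define p where "p x = d * (c * h (norm (S x)))" for x
  \<comment> \<open>Writing \<open>z\<close> as \<open>S (T z)\<close> makes the density a function
    of \<open>T z\<close>, the form that \<open>density_distr\<close> transports.\<close>
  have "P = distr (density lborel (\<lambda>z. ennreal (c * h (norm (S (T z)))))) borel T"
    unfolding Pdef Qd T_def[symmetric] ST ..
  also have "\<dots> = density (distr lborel borel T) (\<lambda>x. ennreal (c * h (norm (S x))))"
    by (rule density_distr[symmetric]) auto
  also have "\<dots> = density lborel (\<lambda>x. ennreal (p x))"
    unfolding Td using d c h_nonneg
    by (subst density_density_eq) (auto simp: p_def ennreal_mult)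
  finally have Pp: "P = density lborel (\<lambda>x. ennreal (p x))" .
  have "prob_space P"
    unfolding Pdef T_def[symmetric] using T_meas measurable_cong_sets[OF Q(2) refl]
    by (intro prob_space.prob_space_distr[OF Q(1)]) blast
  moreover have "p x = p y" if "norm x = norm y" "(column k U \<bullet> x)\<^sup>2 = (column k U \<bullet> y)\<^sup>2" for x y
  proof -
    have "(norm (S x))\<^sup>2 = (norm (S y))\<^sup>2" using that by (simp add: normS)
    then show ?thesis by (simp add: p_def)
  qed
  moreover have "p x < p y" if "norm x = norm y" "(column k U \<bullet> x)\<^sup>2 < (column k U \<bullet> y)\<^sup>2" for x y
  proof -
    have "(l\<^sup>2 - 1) / l\<^sup>2 > 0"
      using sl by (intro divide_pos_pos) auto
    then have "(norm (S y))\<^sup>2 < (norm (S x))\<^sup>2"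
      unfolding normS that(1) using that(2) sl
      by (intro divide_strict_right_mono diff_strict_left_mono mult_strict_left_mono) auto
    then have "norm (S y) < norm (S x)"
      by (simp add: power_less_imp_less_base)
    \<comment> \<open>Monotonicity of \<open>h\<close> is available only at positive radii, so the
      smaller radius must be shown to be nonzero.\<close>
    moreover have "S y \<noteq> 0"
    proof
      assume "S y = 0"
      then have "y = 0" using TS[of y] linT by (metis linear_0)
      then show False using that(2) by simp
    qed
    ultimately show ?thesis
      using h_anti c d by (simp add: p_def)
  qed
  moreover have "p \<in> borel_measurable borel" unfolding p_def by measurable
  moreover have "0 \<le> p x" for x using c d h_nonneg by (simp add: p_def)
  moreover have "norm (column k U) = 1"
    using U by (simp add: orthogonal_matrix_orthonormal_columns)
  ultimately show ?thesis
    using Pp by (intro exI[of _ p] spiked_distribution.intro spiked_distribution_axioms.intro)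
qed

section \<open>The largest eigenvalue\<close>

text \<open>After scaling by \<open>1 / (norm x)\<^sup>2\<close> the outer product has norm at most
  1, so the matrix-valued integral exists.\<close>

lemma norm_outer_product:
  fixes x :: "real ^ 'n"
  shows "norm ((columnvector x :: real ^ 1 ^ 'n) ** rowvector x) = (norm x)\<^sup>2"
proof -
  have row: "((columnvector x :: real ^ 1 ^ 'n) ** rowvector x) $ i = x $ i *\<^sub>R x" for i
    by (simp add: vec_eq_iff matrix_matrix_mult_def columnvector_def rowvector_def)
  show ?thesis
    unfolding norm_vec_def[of "(columnvector x :: real ^ 1 ^ 'n) ** rowvector x"] row
    by (simp add: L2_set_left_distrib[symmetric] power2_eq_square) (simp add: norm_vec_def L2_set_def)
qed

lemma outer_product_vector_mult:
  fixes x v :: "real ^ 'n"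
  shows "((columnvector x :: real ^ 1 ^ 'n) ** rowvector x) *v v = (x \<bullet> v) *\<^sub>R x"
  by (simp add: vec_eq_iff matrix_matrix_mult_def matrix_vector_mult_def columnvector_def rowvector_def
      inner_vec_def sum_distrib_right sum_distrib_left mult_ac)

lemma continuous_outer_product:
  "continuous_on UNIV (\<lambda>x :: real ^ 'n. (columnvector x :: real ^ 1 ^ 'n) ** rowvector x)"
proof -
  have "(\<lambda>x :: real ^ 'n. (columnvector x :: real ^ 1 ^ 'n) ** rowvector x) = (\<lambda>x. \<chi> i j. x $ i * x $ j)"
    by (simp add: fun_eq_iff vec_eq_iff matrix_matrix_mult_def columnvector_def rowvector_def)
  then show ?thesis
    by (simp only:) (intro continuous_intros)
qed

text \<open>The map from a matrix \<open>A\<close> to \<open>w \<bullet> (A *v v)\<close> is linear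
  in finite dimension, hence bounded, and commutes with the integral.\<close>

lemma sign_covariance_inner:
  fixes P :: "(real ^ 'n) measure"
  assumes "prob_space P" and [measurable_cong]: "sets P = sets borel"
  shows "w \<bullet> (sign_covariance P *v v) = (LINT x|P. (v \<bullet> x) * (w \<bullet> x) / (norm x)\<^sup>2)"
proof -
  interpret prob_space P by fact
  let ?A = "\<lambda>x. (1 / (norm x)\<^sup>2) *\<^sub>R ((columnvector x :: real ^ 1 ^ 'n) ** rowvector x)"
  have [measurable]: "(\<lambda>x :: real ^ 'n. (columnvector x :: real ^ 1 ^ 'n) ** rowvector x) \<in> borel_measurable borel"
    by (intro borel_measurable_continuous_onI continuous_outer_product)
  have int: "integrable P ?A"
    by (rule integrable_const_bound[of _ 1]) (auto simp: norm_outer_product)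
  have lin: "linear (\<lambda>A :: real ^ 'n ^ 'n. w \<bullet> (A *v v))"
    by (intro linearI)
      (simp_all add: matrix_vector_mult_add_rdistrib inner_add_right scaleR_matrix_vector_assoc[symmetric])
  have "w \<bullet> (sign_covariance P *v v) = (LINT x|P. w \<bullet> (?A x *v v))"
    unfolding sign_covariance_def using lin int
    by (subst integral_bounded_linear[symmetric]) (auto simp: linear_linear)
  also have "\<dots> = (LINT x|P. (v \<bullet> x) * (w \<bullet> x) / (norm x)\<^sup>2)"
    by (intro Bochner_Integration.integral_cong)
      (simp_all add: scaleR_matrix_vector_assoc[symmetric] outer_product_vector_mult inner_commute)
  finally show ?thesis .
qed

text \<open>One eigenvector is chosen for each eigenvalue. By symmetry they are pairwise orthogonal,
  so there are finitely many; \<open>Max\<close> is meaningful only then.\<close>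

lemma finite_eigenvalues:
  fixes A :: "real ^ 'n ^ 'n"
  assumes sym: "\<And>v w. w \<bullet> (A *v v) = v \<bullet> (A *v w)"
  shows "finite (eigenvalues A)"
proof -
  define e where "e c = (SOME v. v \<noteq> 0 \<and> A *v v = c *\<^sub>R v)" for c
  have e: "e c \<noteq> 0" "A *v e c = c *\<^sub>R e c" if "c \<in> eigenvalues A" for c
    using someI_ex[of "\<lambda>v. v \<noteq> 0 \<and> A *v v = c *\<^sub>R v"] that
    unfolding eigenvalues_def e_def by auto
  have orth: "e c \<bullet> e d = 0" if "c \<in> eigenvalues A" "d \<in> eigenvalues A" "c \<noteq> d" for c d
    using sym[of "e c" "e d"] that by (simp add: e inner_commute)
  have "inj_on e (eigenvalues A)"
    by (intro inj_onI) (metis e(1) inner_eq_zero_iff orth)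
  moreover have "pairwise orthogonal (e ` eigenvalues A)"
    unfolding pairwise_def orthogonal_def using orth by blast
  then have "finite (e ` eigenvalues A)"
    by (rule pairwise_orthogonal_imp_finite)
  ultimately show ?thesis
    by (simp add: finite_image_iff)
qed

text \<open>At a normalised eigenvector the quadratic form equals the eigenvalue, so the bound on
  the unit sphere bounds all eigenvalues.\<close>

lemma largest_eigenvalueI:
  fixes A :: "real ^ 'n ^ 'n"
  assumes sym: "\<And>v w. w \<bullet> (A *v v) = v \<bullet> (A *v w)"
    and max: "\<And>v. norm v = 1 \<Longrightarrow> v \<bullet> (A *v v) \<le> c"
    and u: "u \<noteq> 0" "A *v u = c *\<^sub>R u"
  shows "largest_eigenvalue A = c"
  unfolding largest_eigenvalue_def
proof (rule Max_eqI)
  show "finite (eigenvalues A)" by (rule finite_eigenvalues[OF sym])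
  show "c \<in> eigenvalues A" using u by (auto simp: eigenvalues_def)
  fix d assume "d \<in> eigenvalues A"
  then obtain v where v: "v \<noteq> 0" "A *v v = d *\<^sub>R v" by (auto simp: eigenvalues_def)
  define v' where "v' = (1 / norm v) *\<^sub>R v"
  have "norm v' = 1" "A *v v' = d *\<^sub>R v'"
    using v by (simp_all add: v'_def matrix_vector_mult_scaleR)
  then show "d \<le> c"
    using max[of v'] by (simp add: dot_square_norm)
qed

theorem theorem4:
  fixes U L :: "real ^ 'n ^ 'n" and k :: 'n and P :: "(real ^ 'n) measure"
  assumes "CARD('n) \<ge> 2"
    and "orthogonal_matrix U"
    and "L \<in> spiked_scatter k"
    and "P \<in> elliptical_class U L"
  shows "(largest_eigenvalue (sign_covariance P) > 1 / 2 \<longrightarrow>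
            (\<exists>\<psi>>0. minimizers (pair_objective P) =
                     {\<psi> *\<^sub>R column k U, - (\<psi> *\<^sub>R column k U)}))
       \<and> (largest_eigenvalue (sign_covariance P) \<le> 1 / 2 \<longrightarrow>
            minimizers (pair_objective P) = {0})"
proof -
  let ?u = "column k U"
  obtain p where "spiked_distribution P ?u p"
    using elliptical_class_spiked_distribution[OF assms(2-4)] by blast
  then interpret spiked_distribution P ?u p .
  let ?S = "sign_covariance P"
  have S: "w \<bullet> (?S *v v) = sign_form v w" for v w
    unfolding sign_form_def by (rule sign_covariance_inner[OF prob_space_axioms sets_P])
  have sym: "sign_form v w = sign_form w v" for v w
    by (simp add: sign_form_def mult.commute)
  have "?S *v ?u = sign_form ?u ?u *\<^sub>R ?u"
  proof -
    have "w \<bullet> (?S *v ?u - sign_form ?u ?u *\<^sub>R ?u) = 0" for w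
    proof -
      \<comment> \<open>The vector equation is tested against every \<open>w\<close>. The part of
        \<open>w\<close> orthogonal to \<open>?u\<close> contributes 0, and the part along
        \<open>?u\<close> gives the eigenvalue.\<close>
      define w' where "w' = w - (?u \<bullet> w) *\<^sub>R ?u"
      have "?u \<bullet> w' = 0"
        using norm_u by (simp add: w'_def inner_diff_right dot_square_norm)
      then have "w' \<bullet> (?S *v ?u) = 0"
        by (simp add: S sign_form_orthogonal)
      then have "w \<bullet> (?S *v ?u) = (?u \<bullet> w) * sign_form ?u ?u"
        by (simp add: w'_def inner_diff_left flip: S)
      then show ?thesis
        by (simp add: inner_diff_right inner_commute)
    qed
    then show ?thesis
      by (metis eq_iff_diff_eq_0 inner_eq_zero_iff)
  qed
  moreover have "?u \<noteq> 0" using norm_u by auto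
  ultimately have eig: "largest_eigenvalue ?S = sign_form ?u ?u"
    by (intro largest_eigenvalueI) (simp_all add: S sym sign_form_le)
  have obj: "pair_objective P = objective"
    by (simp add: fun_eq_iff pair_objective_def objective_def pair_kernel_def)
  have "2 \<le> DIM(real ^ 'n)" using assms(1) by simp
  then show ?thesis
    unfolding eig obj using minimizers_objective_spiked minimizers_objective_unspiked by blast
qed

end
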